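(* Consider the ARock iteration with $m$ blocks (as described in the context) for an $r$-Lipschitz operator $T$, $0<r<1$. Suppose the block sequence $i(k)$ is IID uniform on $\{1,\dots,m\}$ with $i(k)$ independent of $\mathcal F^k$, and the sequence of delay vectors $\vec j(0),\vec j(1),\dots$ is an arbitrary (deterministic, possibly unbounded) sequence in $\mathbb N^m$. Let $0\le q<\frac12$, let $c>0$ be arbitrary, and let $\rho=1-\frac1m(1-r^2)$, $\gamma=\rho-cm^{-q}$. Define $$H_1(j)=\Big(1+c^{-1}m^{q-1/2}\big(3+\gamma^{-j}\big)\Big)^{-1},\qquad H_2(j)=2c\,m^{\frac12-q}\gamma^{j},$$ $$R(\eta,\theta)=1-\frac{\eta}{m}(1-r^2)\Big(1-\frac{\eta}{\theta}\Big),$$ and consider the Lyapunov function $$\xi^k=\|x^k-x^*\|^2+\frac1m\sum_{i=1}^\infty c_i\|x^{k+1-i}-x^{k-i}\|^2,\qquad c_i=m^{1/2}\big(1+2(1-r^2)\big)\frac{(\gamma/\rho)^{i}}{1-\gamma/\rho}.$$ Let $\eta^k$ be $\mathcal F^k$-measurable with $\eta^k\le H_1(j(k))$. Then $$\mathbb E[\xi^{k+1}\mid\mathcal G^k]\le R\big(\eta^k,H_2(j(k))\big)\,\xi^k .$$ Additionally, let $\eta^k=H_1(j(k))$. If $j(k)\le bm^q+d$ for some $q\in[0,\frac12)$ and $b,d>0$, then the convergence rate satisfies (as $m\to\infty$) $$R\le 1-\frac1m(1-r^2)\Big(1-\frac1c m^{q-1/2}\big(3+\tfrac32\exp(bc)\big)+o\big(m^{q-\frac12}\big)\Big),$$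 which corresponds to epoch iteration complexity $$I(\epsilon)=\Big(1+\frac1c m^{q-1/2}\big(3+\tfrac32\exp(bc)\big)+o\big(m^{q-\frac12}\big)\Big)\frac{1}{1-r^2}\ln(1/\epsilon).$$
   Context: ARock iteration. $\mathbb H=\mathbb H_1\times\cdots\times\mathbb H_m$ is $\mathbb R^N$ or a separable Hilbert space, decomposed into $m$ orthogonal subspaces; $x\in\mathbb H$ is written $x=(x_1,\dots,x_m)$. $T:\mathbb H\to\mathbb H$ is $r$-Lipschitz with $0<r<1$, $x^*$ is its fixed point, $S=I-T$, and $S_ix$ is the $i$-th block of $Sx$. Given a starting point $x^0\in\mathbb H$, step sizes $\eta^k\in\mathbb R$, random block indices $i(k)\in\{1,\dots,m\}$ and delay vectors $\vec j(k)=(j(k,1),\dots,j(k,m))\in\mathbb N^m$ (with $0\in\mathbb N$), the iterates are $$x_i^{k+1}=x_i^k-\eta^kS_i(\hat x^k)\ \text{ if } i=i(k),\qquad x_i^{k+1}=x_i^k\ \text{ if } i\ne i(k),$$ where $\hat x^k=(x_1^{k-j(k,1)},\dots,x_m^{k-j(k,m)})$ is the delayed iterate (iterates with negative index are read as $x^0$). The current delay is $j(k)=\max_i j(k,i)$. The filtrations are $\mathcal F^k=\sigma(x^0,\dots,x^k,\vec j(0),\dots,\vec j(k))$ and $\mathcal G^k=\sigma(x^0,\dots,x^k)$. In the second part, $R$ denotes $R(\eta^k,H_2(j(k)))$, and the exponent $q$ in the delay bound $bm^q+d$ is the same $q$ that enters $\gamma$, $H_1$ and $H_2$. An epoch is a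 unit of work loosely corresponding to one computation of the full $Sx$, i.e. $m$ single-block iterations. The epoch iteration complexity $I(\epsilon)$ is the number of epochs required to decrease the error below $\epsilon$ times its initial value.
   Formalization: Step sizes are assumed nonnegative and γ>0 in the descent claim; for q=0 the asymptotic claims assume c<1 and (1-c)^{-⌊b+d⌋} ≤ exp(bc). The claim is false or undefined without these (e.g. T=-rI with small η<0; q=0, b=d=1/2, j(k)=1). *)

theory Defs
  imports "HOL-Probability.Probability" "HOL-Library.Landau_Symbols"
begin

text \<open>
  The product \<open>H\<^sub>1 \<times> \<dots> \<times> H\<^sub>m\<close> is modelled internally: the Hilbert space is a type, and the
  \<open>H\<^sub>i\<close> are pairwise orthogonal subspaces \<open>V i\<close> (for \<open>i \<in> {1..m}\<close>) that span it.
  Closedness of the \<open>V i\<close> follows.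
\<close>

definition orthogonal_decomposition :: "nat \<Rightarrow> (nat \<Rightarrow> 'h::real_inner set) \<Rightarrow> bool" where
  "orthogonal_decomposition m V \<longleftrightarrow>
     (\<forall>i\<in>{1..m}. subspace (V i)) \<and>
     (\<forall>i\<in>{1..m}. \<forall>l\<in>{1..m}. i \<noteq> l \<longrightarrow> (\<forall>u\<in>V i. \<forall>v\<in>V l. orthogonal u v)) \<and>
     (\<forall>y. \<exists>f\<in>(\<Pi>\<^sub>E i\<in>{1..m}. V i). (\<Sum>i=1..m. f i) = y)"

definition block :: "nat \<Rightarrow> (nat \<Rightarrow> 'h::real_inner set) \<Rightarrow> 'h \<Rightarrow> nat \<Rightarrow> 'h" where
  "block m V y = (THE f. f \<in> (\<Pi>\<^sub>E i\<in>{1..m}. V i) \<and> (\<Sum>i=1..m. f i) = y)"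

text \<open>
  A delay family \<open>j k i\<close> is deterministic. Truncated subtraction on \<^typ>\<open>nat\<close> implements the
  convention that iterates with negative index are the starting point.
\<close>

definition delayed_iterate ::
  "nat \<Rightarrow> (nat \<Rightarrow> 'h::real_inner set) \<Rightarrow> (nat \<Rightarrow> nat \<Rightarrow> nat) \<Rightarrow> (nat \<Rightarrow> 'w \<Rightarrow> 'h) \<Rightarrow> nat \<Rightarrow> 'w \<Rightarrow> 'h" where
  "delayed_iterate m V j x k \<omega> = (\<Sum>i=1..m. block m V (x (k - j k i) \<omega>) i)"

definition current_delay :: "nat \<Rightarrow> (nat \<Rightarrow> nat \<Rightarrow> nat) \<Rightarrow> nat \<Rightarrow> nat" where
  "current_delay m j k = Max (j k ` {1..m})"

definition filtration_G :: "'w measure \<Rightarrow> (nat \<Rightarrow> 'w \<Rightarrow> 'h::topological_space) \<Rightarrow> nat \<Rightarrow> 'w measure" where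
  "filtration_G M x k =
     sigma (space M) (\<Union>l\<in>{..k}. sets (vimage_algebra (space M) (x l) borel))"

definition filtration_F ::
  "'w measure \<Rightarrow> nat \<Rightarrow> (nat \<Rightarrow> nat \<Rightarrow> nat) \<Rightarrow> (nat \<Rightarrow> 'w \<Rightarrow> 'h::topological_space) \<Rightarrow> nat \<Rightarrow> 'w measure" where
  "filtration_F M m j x k =
     sigma (space M)
       ((\<Union>l\<in>{..k}. sets (vimage_algebra (space M) (x l) borel)) \<union>
        (\<Union>l\<in>{..k}. \<Union>i\<in>{1..m}. sets (vimage_algebra (space M) (\<lambda>_. j l i) (count_space UNIV))))"

text \<open>
  The starting point \<open>x 0\<close> may be random; square integrability, automatic for a deterministic
  starting point, makes the expectations below finite.
\<close>

locale arock = prob_space M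
  for M :: "'w measure" +
  fixes m :: nat
    and V :: "nat \<Rightarrow> 'h::{real_inner, banach, second_countable_topology} set"
    and T :: "'h \<Rightarrow> 'h" and r :: real and xstar :: 'h
    and x :: "nat \<Rightarrow> 'w \<Rightarrow> 'h"
    and blk :: "nat \<Rightarrow> 'w \<Rightarrow> nat"
    and \<eta> :: "nat \<Rightarrow> 'w \<Rightarrow> real"
    and j :: "nat \<Rightarrow> nat \<Rightarrow> nat"
  assumes m_pos: "1 \<le> m"
    and decomposition: "orthogonal_decomposition m V"
    and lipschitz: "r-lipschitz_on UNIV T"
    and fixed_point: "T xstar = xstar"
    and start_measurable: "x 0 \<in> borel_measurable M"
    and start_integrable: "integrable M (\<lambda>\<omega>. (norm (x 0 \<omega>))\<^sup>2)"
    and step: "\<And>k \<omega> i. \<omega> \<in> space M \<Longrightarrow> i \<in> {1..m} \<Longrightarrow>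
       block m V (x (Suc k) \<omega>) i =
         (if i = blk k \<omega>
          then block m V (x k \<omega>) i
                 - \<eta> k \<omega> *\<^sub>R block m V (delayed_iterate m V j x k \<omega> - T (delayed_iterate m V j x k \<omega>)) i
          else block m V (x k \<omega>) i)"
    and blk_indep: "indep_vars (\<lambda>_. count_space {1..m}) blk UNIV"
    and blk_uniform: "\<And>k. distr M (count_space {1..m}) (blk k) = uniform_count_measure {1..m}"
    and blk_indep_F: "\<And>k. indep_set (sets (vimage_algebra (space M) (blk k) (count_space {1..m})))
                              (sets (filtration_F M m j x k))"
    and step_size_measurable: "\<And>k. \<eta> k \<in> borel_measurable (filtration_F M m j x k)"

definition arock_rho :: "real \<Rightarrow> nat \<Rightarrow> real" where
  "arock_rho r m = 1 - 1 / real m * (1 - r\<^sup>2)"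

definition arock_gamma :: "real \<Rightarrow> real \<Rightarrow> real \<Rightarrow> nat \<Rightarrow> real" where
  "arock_gamma r c q m = arock_rho r m - c * real m powr (- q)"

definition arock_H1 :: "real \<Rightarrow> real \<Rightarrow> real \<Rightarrow> nat \<Rightarrow> nat \<Rightarrow> real" where
  "arock_H1 r c q m j =
     inverse (1 + inverse c * real m powr (q - 1/2) * (3 + arock_gamma r c q m powi (- int j)))"

definition arock_H2 :: "real \<Rightarrow> real \<Rightarrow> real \<Rightarrow> nat \<Rightarrow> nat \<Rightarrow> real" where
  "arock_H2 r c q m j = 2 * c * real m powr (1/2 - q) * arock_gamma r c q m ^ j"

definition arock_R :: "real \<Rightarrow> nat \<Rightarrow> real \<Rightarrow> real \<Rightarrow> real" where
  "arock_R r m \<eta> \<theta> = 1 - \<eta> / real m * (1 - r\<^sup>2) * (1 - \<eta> / \<theta>)"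

definition arock_coeff :: "real \<Rightarrow> real \<Rightarrow> real \<Rightarrow> nat \<Rightarrow> nat \<Rightarrow> real" where
  "arock_coeff r c q m i =
     real m powr (1/2) * (1 + 2 * (1 - r\<^sup>2)) *
       ((arock_gamma r c q m / arock_rho r m) ^ i / (1 - arock_gamma r c q m / arock_rho r m))"

text \<open>The series index is shifted by one: the summand with index \<open>n\<close> belongs to \<open>i = n + 1\<close>.\<close>

definition arock_xi ::
  "real \<Rightarrow> real \<Rightarrow> real \<Rightarrow> nat \<Rightarrow> 'h::real_normed_vector \<Rightarrow> (nat \<Rightarrow> 'w \<Rightarrow> 'h) \<Rightarrow> nat \<Rightarrow> 'w \<Rightarrow> real" where
  "arock_xi r c q m xstar x k \<omega> =
     (norm (x k \<omega> - xstar))\<^sup>2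
     + 1 / real m * (\<Sum>n. arock_coeff r c q m (Suc n)
                            * (norm (x (k + 1 - Suc n) \<omega> - x (k - Suc n) \<omega>))\<^sup>2)"

text \<open>
  An epoch is \<open>m\<close> iterations, so a number of iterations is divided by \<open>m\<close> without rounding.
  The error is required to stay below the threshold, since it need not be monotone.
\<close>

definition epoch_complexity :: "nat \<Rightarrow> (nat \<Rightarrow> real) \<Rightarrow> real \<Rightarrow> real" where
  "epoch_complexity m err \<epsilon> = real (LEAST K. \<forall>k\<ge>K. err k \<le> \<epsilon> * err 0) / real m"

end

theory Submission
  imports Defs "HOL-Real_Asymp.Real_Asymp"
begin

text \<open>
  Fix an iteration and write \<open>s = 1 - r\<^sup>2\<close>, \<open>u = x\<^sup>k - x\<^sup>*\<close>, \<open>z\<close> for the delayed iterate minus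
  \<open>x\<^sup>*\<close>, \<open>y\<close> for the residual \<open>S\<close> at the delayed iterate, and \<open>\<theta>\<close> for \<open>H\<^sub>2\<close> at the current delay.
  Averaged over the uniform block, the squared distance to \<open>x\<^sup>*\<close> becomes
  \<open>\<parallel>u\<parallel>\<^sup>2 - (2\<eta>/m) \<langle>u, y\<rangle> + (\<eta>\<^sup>2/m) \<parallel>y\<parallel>\<^sup>2\<close>, because the blocks are orthogonal and sum to the
  whole vector. That \<open>T\<close> contracts towards \<open>x\<^sup>*\<close> says \<open>2 \<langle>z, y\<rangle> \<ge> \<parallel>y\<parallel>\<^sup>2 + s \<parallel>z\<parallel>\<^sup>2\<close>.
  Replacing \<open>z\<close> by \<open>u\<close> produces two mixed terms with the delay error \<open>u - z\<close>; Young's inequality,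
  with weights chosen so that the price in the delay error is free of \<open>\<eta>\<close>, bounds them at the cost of
  \<open>(1/2 + s) \<theta> \<parallel>u - z\<parallel>\<^sup>2\<close>, of a multiple of \<open>\<parallel>y\<parallel>\<^sup>2\<close>, and of the factor \<open>1 - \<eta>/\<theta>\<close> in the rate
  (\<open>averaged_step_descent\<close>). The condition \<open>\<eta> \<le> H\<^sub>1\<close> makes the total coefficient of \<open>\<parallel>y\<parallel>\<^sup>2\<close>
  non-positive (\<open>step_size_admissible\<close>).

  The delay error is a sum of past increments. A Cauchy-Schwarz inequality with the geometric
  weights \<open>(\<rho>/\<gamma>)\<^sup>i\<close> bounds its square by a combination of squared increments with coefficients
  decaying like \<open>(\<gamma>/\<rho>)\<^sup>i\<close> (\<open>delay_error_bound\<close>). The memory part of the Lyapunov function has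
  coefficients \<open>c\<^sub>i\<close> with the same decay, so that moving them one step into the past frees a
  multiple of \<open>(\<gamma>/\<rho>)\<^sup>i\<close>; the constants are such that this pays for the delay error and still
  leaves the contraction factor \<open>R\<close> (\<open>arock_coeff_absorbs_delay_error\<close>). These inequalities hold
  pathwise. Probability enters the descent only through the independence of the current block from the past,
  which turns the conditional expectation into the average over the blocks
  (\<open>real_cond_exp_independent_choice\<close>); since the delays are deterministic, conditioning on the past
  delays adds no information.

  For \<open>\<eta> = H\<^sub>1\<close>, elementary estimates give
  \<open>R \<le> 1 - (s/m) (1 - c\<^sup>-\<^sup>1 m\<^bsup>q-1/2\<^esup> (3 + (3/2) \<gamma>\<^bsup>-j\<^esup>))\<close> (\<open>arock_rate_le\<close>). When \<open>q > 0\<close>, the bound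
  \<open>j \<le> b m\<^sup>q + d\<close> and \<open>\<gamma> = 1 - c m\<^bsup>-q\<^esup> - s/m\<close> give \<open>\<gamma>\<^bsup>-j\<^esup> \<le> exp (b c) + o(1)\<close> uniformly in the delays;
  when \<open>q = 0\<close>, \<open>\<gamma>\<close> tends to \<open>1 - c\<close> and the hypothesis on \<open>b + d\<close> takes this role
  (\<open>inverse_gamma_power_bound\<close>). Finally, with \<open>A = O(m\<^bsup>q-1/2\<^esup>)\<close>, the powers of
  \<open>1 - (s/m) (1 - A)\<close> need \<open>(m/s) (1 + A + O(A\<^sup>2)) ln (1/\<epsilon>) + O(1)\<close> iterations to fall below \<open>\<epsilon>\<close>, and
  \<open>A\<^sup>2\<close> and \<open>1/m\<close> are both \<open>o(m\<^bsup>q-1/2\<^esup>)\<close> because \<open>0 \<le> q < 1/2\<close> (\<open>epoch_complexity_expansion\<close>). The expected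
  Lyapunov function and the expected squared distance are dominated by such a geometric sequence,
  and both start at the same value.
\<close>

text \<open>
  Block indices start at 1. The simplifier would otherwise rewrite \<open>{1..m}\<close> to \<open>{Suc 0..m}\<close>, to which
  facts stated for \<open>{1..m}\<close> no longer apply.
\<close>

declare One_nat_def [simp del]

section \<open>Orthogonal decompositions\<close>

lemma inner_orthogonal_sum:
  assumes "orthogonal_decomposition m V" "f \<in> (\<Pi>\<^sub>E i\<in>{1..m}. V i)" "i \<in> {1..m}" "v \<in> V i"
  shows "inner v (\<Sum>l=1..m. f l) = inner v (f i)"
proof -
  have "inner v (\<Sum>l=1..m. f l) = (\<Sum>l=1..m. if l = i then inner v (f i) else 0)"
    unfolding inner_sum_right
  proof (rule sum.cong)
    fix l assume l: "l \<in> {1..m}"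
    then have "f l \<in> V l"
      using assms(2) by (auto simp: PiE_iff)
    then show "inner v (f l) = (if l = i then inner v (f i) else 0)"
      using assms l by (auto simp: orthogonal_decomposition_def orthogonal_def)
  qed simp
  then show ?thesis
    using assms(3) by simp
qed

text \<open>
  The difference of two decompositions of the same vector is orthogonal to itself in every block.
\<close>

lemma orthogonal_decomposition_unique:
  assumes V: "orthogonal_decomposition m V"
    and f: "f \<in> (\<Pi>\<^sub>E i\<in>{1..m}. V i)" and g: "g \<in> (\<Pi>\<^sub>E i\<in>{1..m}. V i)"
    and eq: "(\<Sum>i=1..m. f i) = (\<Sum>i=1..m. g i)"
  shows "f = g"
proof (rule PiE_ext[OF f g])
  fix i assume i: "i \<in> {1..m}"
  have "f i \<in> V i" "g i \<in> V i" "subspace (V i)"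
    using f g i V by (auto simp: PiE_iff orthogonal_decomposition_def)
  then have v: "f i - g i \<in> V i"
    by (simp add: subspace_diff)
  have "inner (f i - g i) (f i) = inner (f i - g i) (g i)"
    using inner_orthogonal_sum[OF V f i v] inner_orthogonal_sum[OF V g i v] eq by simp
  then have "inner (f i - g i) (f i - g i) = 0"
    by (simp add: inner_diff_right)
  then show "f i = g i"
    by simp
qed

lemma block_ex1:
  assumes V: "orthogonal_decomposition m V"
  shows "\<exists>!f. f \<in> (\<Pi>\<^sub>E i\<in>{1..m}. V i) \<and> (\<Sum>i=1..m. f i) = y"
proof -
  obtain f where "f \<in> (\<Pi>\<^sub>E i\<in>{1..m}. V i)" "(\<Sum>i=1..m. f i) = y"
    using V unfolding orthogonal_decomposition_def by blast
  then show ?thesis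
    using orthogonal_decomposition_unique[OF V] by (metis (no_types, lifting))
qed

lemma block_sum:
  assumes "orthogonal_decomposition m V"
  shows "(\<Sum>i=1..m. block m V y i) = y"
  using theI'[OF block_ex1[OF assms, of y]] unfolding block_def by blast

lemma block_PiE:
  assumes "orthogonal_decomposition m V"
  shows "block m V y \<in> (\<Pi>\<^sub>E i\<in>{1..m}. V i)"
  using theI'[OF block_ex1[OF assms, of y]] unfolding block_def by blast

lemma block_mem:
  assumes "orthogonal_decomposition m V" "i \<in> {1..m}"
  shows "block m V y i \<in> V i"
  using block_PiE[OF assms(1)] assms(2) by (auto simp: PiE_iff)

lemma block_eqI:
  assumes V: "orthogonal_decomposition m V"
    and f: "\<And>i. i \<in> {1..m} \<Longrightarrow> f i \<in> V i" and sum: "(\<Sum>i=1..m. f i) = y"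
    and i: "i \<in> {1..m}"
  shows "block m V y i = f i"
proof -
  have "block m V y = restrict f {1..m}"
    by (rule orthogonal_decomposition_unique[OF V block_PiE[OF V]])
       (use f sum in \<open>auto simp: block_sum[OF V]\<close>)
  then show ?thesis
    using i by simp
qed

text \<open>
  The projections onto the blocks are self-adjoint and idempotent; this is the form
  that yields Parseval's identity.
\<close>

lemma inner_block:
  assumes V: "orthogonal_decomposition m V" and i: "i \<in> {1..m}"
  shows "inner (block m V y i) z = inner (block m V y i) (block m V z i)"
  using inner_orthogonal_sum[OF V block_PiE[OF V] i block_mem[OF V i], of y z]
  by (simp add: block_sum[OF V])

lemma norm_block_sum:
  assumes V: "orthogonal_decomposition m V"
  shows "(\<Sum>i=1..m. (norm (block m V y i))\<^sup>2) = (norm y)\<^sup>2"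
proof -
  have "(norm y)\<^sup>2 = inner (\<Sum>i=1..m. block m V y i) y"
    by (simp add: block_sum[OF V] power2_norm_eq_inner)
  also have "\<dots> = (\<Sum>i=1..m. (norm (block m V y i))\<^sup>2)"
    unfolding inner_sum_left
    by (intro sum.cong refl) (simp only: inner_block[OF V, of _ y y] power2_norm_eq_inner)
  finally show ?thesis ..
qed

lemma norm_block_le:
  assumes V: "orthogonal_decomposition m V" and i: "i \<in> {1..m}"
  shows "norm (block m V y i) \<le> norm y"
proof (rule power2_le_imp_le)
  have "(norm (block m V y i))\<^sup>2 \<le> (\<Sum>i=1..m. (norm (block m V y i))\<^sup>2)"
    by (rule member_le_sum) (use i in auto)
  then show "(norm (block m V y i))\<^sup>2 \<le> (norm y)\<^sup>2"
    by (simp add: norm_block_sum[OF V])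
qed simp

lemma bounded_linear_block:
  assumes V: "orthogonal_decomposition m V" and i: "i \<in> {1..m}"
  shows "bounded_linear (\<lambda>y. block m V y i)"
proof (rule bounded_linear_intro[where K = 1])
  have sub: "\<And>l. l \<in> {1..m} \<Longrightarrow> subspace (V l)"
    using V by (auto simp: orthogonal_decomposition_def)
  show "block m V (y + z) i = block m V y i + block m V z i" for y z
    by (rule block_eqI[OF V _ _ i])
       (auto simp: sub subspace_add block_mem[OF V] sum.distrib block_sum[OF V])
  show "block m V (a *\<^sub>R y) i = a *\<^sub>R block m V y i" for a y
    by (rule block_eqI[OF V _ _ i])
       (auto simp: sub subspace_scale block_mem[OF V] block_sum[OF V] simp flip: scaleR_right.sum)
qed (simp add: norm_block_le[OF V i])

section \<open>The error caused by the delays\<close>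

lemma norm_sum_weighted_Cauchy_Schwarz:
  fixes a :: "nat \<Rightarrow> 'h::real_normed_vector"
  assumes w: "\<And>l. 0 < w l"
  shows "(norm (\<Sum>l<n. a l))\<^sup>2 \<le> (\<Sum>l<n. w l) * (\<Sum>l<n. (norm (a l))\<^sup>2 / w l)"
proof -
  have "(norm (\<Sum>l<n. a l))\<^sup>2 \<le> (\<Sum>l<n. norm (a l))\<^sup>2"
    by (intro power_mono norm_sum) simp
  also have "\<dots> = (\<Sum>l<n. sqrt (w l) * (norm (a l) / sqrt (w l)))\<^sup>2"
    using w by (intro arg_cong[where f = "\<lambda>t. t\<^sup>2"] sum.cong refl)
      (metis nonzero_mult_div_cancel_left order_less_irrefl real_sqrt_gt_zero times_divide_eq_right)
  also have "\<dots> \<le> (\<Sum>l<n. (sqrt (w l))\<^sup>2) * (\<Sum>l<n. (norm (a l) / sqrt (w l))\<^sup>2)"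
    by (rule Cauchy_Schwarz_ineq_sum)
  also have "\<dots> = (\<Sum>l<n. w l) * (\<Sum>l<n. (norm (a l))\<^sup>2 / w l)"
    using w by (simp add: power_divide less_imp_le)
  finally show ?thesis .
qed

text \<open>
  Truncated subtraction is harmless: beyond index \<open>k\<close> all summands vanish.
\<close>

lemma telescope_truncated:
  fixes u :: "nat \<Rightarrow> 'h::ab_group_add"
  shows "u k - u (k - n) = (\<Sum>l<n. u (k - l) - u (k - Suc l))"
  by (induction n) (auto simp: algebra_simps)

text \<open>
  Block \<open>i\<close> of the delay error telescopes into the \<open>i\<close>-th blocks of the last \<open>j k i\<close> increments.
  The weighted Cauchy-Schwarz inequality applies in each block, where the sum over \<open>j k i\<close> increments
  may be enlarged to the current delay; summing over the blocks restores the full increments by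
  Parseval. Increments from before the start vanish, so that \<open>k\<close> of them remain.
\<close>

lemma delay_error_bound:
  fixes x :: "nat \<Rightarrow> 'w \<Rightarrow> 'h::real_inner"
  assumes V: "orthogonal_decomposition m V" and w: "\<And>l. 0 < w l"
  shows "(norm (x k \<omega> - delayed_iterate m V j x k \<omega>))\<^sup>2
    \<le> (\<Sum>l<current_delay m j k. w l) * (\<Sum>l<k. (norm (x (k - l) \<omega> - x (k - Suc l) \<omega>))\<^sup>2 / w l)"
proof -
  let ?P = "\<lambda>i y. block m V y i"
  let ?J = "current_delay m j k"
  define \<Delta> where "\<Delta> l = x (k - l) \<omega> - x (k - Suc l) \<omega>" for l
  have \<Delta>_0: "\<Delta> l = 0" if "\<not> l < k" for l
    using that by (simp add: \<Delta>_def)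
  have lin: "bounded_linear (?P i)" if "i \<in> {1..m}" for i
    by (rule bounded_linear_block[OF V that])
  have W: "0 \<le> (\<Sum>l<n. w l)" for n
    by (intro sum_nonneg) (simp add: w less_imp_le)
  let ?e = "\<lambda>i. ?P i (x k \<omega> - x (k - j k i) \<omega>)"
  have e_mem: "?e i \<in> V i" if "i \<in> {1..m}" for i
    by (rule block_mem[OF V that])
  have "x k \<omega> - delayed_iterate m V j x k \<omega> = (\<Sum>i=1..m. ?P i (x k \<omega>)) - (\<Sum>i=1..m. ?P i (x (k - j k i) \<omega>))"
    by (simp add: delayed_iterate_def block_sum[OF V])
  also have "\<dots> = (\<Sum>i=1..m. ?e i)"
    unfolding sum_subtractf[symmetric]
    by (intro sum.cong refl) (simp add: linear_diff[OF bounded_linear.linear[OF lin]])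
  finally have blk: "?P i (x k \<omega> - delayed_iterate m V j x k \<omega>) = ?e i" if "i \<in> {1..m}" for i
    using block_eqI[OF V e_mem _ that] by simp
  have "(norm (x k \<omega> - delayed_iterate m V j x k \<omega>))\<^sup>2 = (\<Sum>i=1..m. (norm (?e i))\<^sup>2)"
    using norm_block_sum[OF V, of "x k \<omega> - delayed_iterate m V j x k \<omega>"] by (simp add: blk)
  also have "\<dots> \<le> (\<Sum>i=1..m. (\<Sum>l<?J. w l) * (\<Sum>l<?J. (norm (?P i (\<Delta> l)))\<^sup>2 / w l))"
  proof (rule sum_mono)
    fix i assume i: "i \<in> {1..m}"
    have le: "j k i \<le> ?J"
      unfolding current_delay_def using i by (intro Max_ge) auto
    have "?e i = (\<Sum>l<j k i. ?P i (\<Delta> l))"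
      unfolding telescope_truncated[of "\<lambda>k. x k \<omega>" k "j k i"] \<Delta>_def
      by (rule linear_sum[OF bounded_linear.linear[OF lin[OF i]]])
    then have "(norm (?e i))\<^sup>2 \<le> (\<Sum>l<j k i. w l) * (\<Sum>l<j k i. (norm (?P i (\<Delta> l)))\<^sup>2 / w l)"
      using norm_sum_weighted_Cauchy_Schwarz[OF w] by simp
    also have "\<dots> \<le> (\<Sum>l<?J. w l) * (\<Sum>l<?J. (norm (?P i (\<Delta> l)))\<^sup>2 / w l)"
      by (intro mult_mono sum_mono2 W sum_nonneg) (use w le in \<open>auto simp: less_imp_le\<close>)
    finally show "(norm (?e i))\<^sup>2 \<le> (\<Sum>l<?J. w l) * (\<Sum>l<?J. (norm (?P i (\<Delta> l)))\<^sup>2 / w l)" .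
  qed
  also have "\<dots> = (\<Sum>l<?J. w l) * (\<Sum>l<?J. (\<Sum>i=1..m. (norm (?P i (\<Delta> l)))\<^sup>2) / w l)"
    unfolding sum_distrib_left[symmetric] sum_divide_distrib by (subst sum.swap) simp
  also have "\<dots> = (\<Sum>l<?J. w l) * (\<Sum>l<?J. (norm (\<Delta> l))\<^sup>2 / w l)"
    by (simp only: norm_block_sum[OF V])
  also have "(\<Sum>l<?J. (norm (\<Delta> l))\<^sup>2 / w l) = (\<Sum>l\<in>{..<?J} \<inter> {..<k}. (norm (\<Delta> l))\<^sup>2 / w l)"
    by (intro sum.mono_neutral_right) (auto simp: \<Delta>_0)
  also have "(\<Sum>l<?J. w l) * \<dots> \<le> (\<Sum>l<?J. w l) * (\<Sum>l<k. (norm (\<Delta> l))\<^sup>2 / w l)"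
    by (intro mult_left_mono W sum_mono2) (use w in \<open>auto simp: less_imp_le\<close>)
  finally show ?thesis
    by (simp add: \<Delta>_def)
qed

section \<open>One averaged step\<close>

text \<open>
  The contraction hypothesis is \<open>2 \<langle>z, y\<rangle> \<ge> \<parallel>y\<parallel>\<^sup>2 + s \<parallel>z\<parallel>\<^sup>2\<close> in disguise. With \<open>z = u - d\<close> it leaves
  the mixed terms \<open>2 \<eta> s \<langle>u, d\<rangle>\<close> and \<open>- 2 \<eta> \<langle>d, y\<rangle>\<close>. Completing the squares \<open>\<parallel>\<eta> u - \<theta> d\<parallel>\<^sup>2\<close> and
  \<open>\<parallel>2 \<eta> y + \<theta> d\<parallel>\<^sup>2\<close> bounds them by multiples of \<open>\<theta> \<parallel>d\<parallel>\<^sup>2\<close> free of \<open>\<eta>\<close>, plus terms quadratic in \<open>\<eta>\<close>: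
  the one in \<open>u\<close> is the loss \<open>\<eta>/\<theta>\<close> in the rate, the one in \<open>y\<close> is covered by the condition on \<open>\<eta>\<close>.
  The parameter \<open>\<kappa>\<close> makes room for the newest increment, which enters the Lyapunov function with
  weight \<open>c\<^sub>1/m\<close>.
\<close>

lemma averaged_step_descent:
  fixes u z y :: "'h::real_inner" and s \<eta> \<theta> \<kappa> :: real
  assumes contr: "(norm (z - y))\<^sup>2 \<le> (1 - s) * (norm z)\<^sup>2"
    and s: "0 \<le> s" and \<eta>: "0 \<le> \<eta>" and \<theta>: "0 < \<theta>"
    and step_size: "\<eta> * (1 + \<kappa> + 2 / \<theta>) \<le> 1"
  shows "\<eta>\<^sup>2 * (1 + \<kappa>) * (norm y)\<^sup>2 - 2 * \<eta> * inner u y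
    \<le> (1/2 + s) * \<theta> * (norm (u - z))\<^sup>2 - \<eta> * s * (1 - \<eta> / \<theta>) * (norm u)\<^sup>2"
proof -
  define d where "d = u - z"
  have z: "z = u - d"
    by (simp add: d_def)
  have "(norm y)\<^sup>2 + s * (norm z)\<^sup>2 \<le> 2 * inner z y"
    using contr by (simp add: power2_norm_eq_inner algebra_simps inner_commute)
  then have "(norm y)\<^sup>2 + s * ((norm u)\<^sup>2 - 2 * inner u d + (norm d)\<^sup>2) + 2 * inner d y \<le> 2 * inner u y"
    by (simp add: z power2_norm_eq_inner algebra_simps inner_commute)
  from mult_left_mono[OF this \<eta>]
  have 1: "\<eta> * (norm y)\<^sup>2 + \<eta> * s * (norm u)\<^sup>2 - \<eta> * s * 2 * inner u d + \<eta> * s * (norm d)\<^sup>2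
      + 2 * \<eta> * inner d y \<le> 2 * \<eta> * inner u y"
    by (simp add: algebra_simps)
  have "0 \<le> (norm (\<eta> *\<^sub>R u - \<theta> *\<^sub>R d))\<^sup>2 / \<theta>"
    using \<theta> by simp
  also have "(norm (\<eta> *\<^sub>R u - \<theta> *\<^sub>R d))\<^sup>2 = \<eta>\<^sup>2 * (norm u)\<^sup>2 - 2 * \<eta> * \<theta> * inner u d + \<theta>\<^sup>2 * (norm d)\<^sup>2"
    unfolding power2_norm_eq_inner by (simp add: algebra_simps inner_commute power2_eq_square)
  also have "\<dots> / \<theta> = \<eta>\<^sup>2 / \<theta> * (norm u)\<^sup>2 - 2 * \<eta> * inner u d + \<theta> * (norm d)\<^sup>2"
    using \<theta> by (simp add: field_simps power2_eq_square)
  finally have "0 \<le> s * (\<eta>\<^sup>2 / \<theta> * (norm u)\<^sup>2 - 2 * \<eta> * inner u d + \<theta> * (norm d)\<^sup>2)"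
    using s by simp
  then have 2: "\<eta> * s * 2 * inner u d \<le> s * \<eta>\<^sup>2 / \<theta> * (norm u)\<^sup>2 + s * \<theta> * (norm d)\<^sup>2"
    by (simp add: algebra_simps)
  have "0 \<le> (norm ((2 * \<eta>) *\<^sub>R y + \<theta> *\<^sub>R d))\<^sup>2 / (2 * \<theta>)"
    using \<theta> by simp
  also have "(norm ((2 * \<eta>) *\<^sub>R y + \<theta> *\<^sub>R d))\<^sup>2 = 4 * \<eta>\<^sup>2 * (norm y)\<^sup>2 + 4 * \<eta> * \<theta> * inner d y + \<theta>\<^sup>2 * (norm d)\<^sup>2"
    unfolding power2_norm_eq_inner by (simp add: algebra_simps inner_commute power2_eq_square)
  also have "\<dots> / (2 * \<theta>) = 2 / \<theta> * \<eta>\<^sup>2 * (norm y)\<^sup>2 + 2 * \<eta> * inner d y + \<theta> / 2 * (norm d)\<^sup>2"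
    using \<theta> by (simp add: field_simps power2_eq_square)
  finally have 3: "- (2 * \<eta> * inner d y) \<le> 2 / \<theta> * \<eta>\<^sup>2 * (norm y)\<^sup>2 + \<theta> / 2 * (norm d)\<^sup>2"
    by simp
  have 4: "\<eta>\<^sup>2 * (1 + \<kappa> + 2 / \<theta>) * (norm y)\<^sup>2 \<le> \<eta> * (norm y)\<^sup>2"
    using mult_right_mono[OF mult_left_mono[OF step_size \<eta>], of "(norm y)\<^sup>2"]
    by (simp add: power2_eq_square mult.assoc)
  have 5: "0 \<le> \<eta> * s * (norm d)\<^sup>2"
    using s \<eta> by simp
  have "\<eta>\<^sup>2 * (1 + \<kappa>) * (norm y)\<^sup>2 - 2 * \<eta> * inner u y
    \<le> (\<theta> / 2 + s * \<theta>) * (norm d)\<^sup>2 - \<eta> * s * (norm u)\<^sup>2 + s * \<eta>\<^sup>2 / \<theta> * (norm u)\<^sup>2"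
    using 1 2 3 4 5 by (simp add: algebra_simps)
  also have "\<dots> = (1/2 + s) * \<theta> * (norm d)\<^sup>2 - \<eta> * s * (1 - \<eta> / \<theta>) * (norm u)\<^sup>2"
    by (simp add: algebra_simps power2_eq_square)
  finally show ?thesis
    by (simp add: d_def)
qed

section \<open>The constants of the Lyapunov function\<close>

lemma arock_rho_bounds:
  assumes "0 < r" "r < 1" "1 \<le> m"
  shows "0 < arock_rho r m" "arock_rho r m \<le> 1"
proof -
  have r2: "0 < r\<^sup>2" "r\<^sup>2 < 1"
    using assms by (auto simp: power_less_one_iff)
  have "1 / real m * (1 - r\<^sup>2) \<le> 1 * (1 - r\<^sup>2)"
    using r2 assms(3) by (intro mult_right_mono) auto
  also have "\<dots> < 1"
    using assms by simp
  finally show "0 < arock_rho r m"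
    by (simp add: arock_rho_def)
  show "arock_rho r m \<le> 1"
    using r2 by (simp add: arock_rho_def)
qed

context
  fixes r c q :: real and m :: nat
  assumes r: "0 < r" "r < 1" and c: "0 < c" and m: "1 \<le> m"
    and \<gamma>_pos: "0 < arock_gamma r c q m"
begin

lemma arock_gamma_less_rho: "arock_gamma r c q m < arock_rho r m"
  using c m by (simp add: arock_gamma_def)

lemma arock_gamma_le_1: "arock_gamma r c q m \<le> 1"
  using arock_gamma_less_rho arock_rho_bounds[OF r m] by linarith

lemma one_minus_gamma_rho:
  "1 - arock_gamma r c q m / arock_rho r m = c * real m powr (- q) / arock_rho r m"
  using arock_rho_bounds[OF r m] by (simp add: arock_gamma_def field_simps)

lemma arock_coeff_eq:
  "arock_coeff r c q m i = real m powr (1/2) * (1 + 2 * (1 - r\<^sup>2)) * arock_rho r m / (c * real m powr (- q))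
     * (arock_gamma r c q m / arock_rho r m) ^ i"
  unfolding arock_coeff_def one_minus_gamma_rho by simp

lemma arock_coeff_nonneg: "0 \<le> arock_coeff r c q m i"
proof -
  have "r\<^sup>2 < 1"
    using r by (auto simp: power_less_one_iff)
  then show ?thesis
    unfolding arock_coeff_eq using arock_rho_bounds[OF r m] \<gamma>_pos c by simp
qed

lemma arock_H2_pos: "0 < arock_H2 r c q m n"
  unfolding arock_H2_def using c m \<gamma>_pos by simp

text \<open>
  This identity links the two step size constants: the term \<open>\<gamma>\<^bsup>-j\<^esup>\<close> in \<open>H\<^sub>1\<close> is the price \<open>2/\<theta>\<close> of Young's
  inequality with \<open>\<theta> = H\<^sub>2\<close>.
\<close>

lemma two_over_arock_H2:
  "2 / arock_H2 r c q m n = inverse c * real m powr (q - 1/2) * arock_gamma r c q m powi (- int n)"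
proof -
  have "real m powr (1/2 - q) = inverse (real m powr (q - 1/2))"
    by (simp flip: powr_minus)
  then show ?thesis
    using c by (simp add: arock_H2_def power_int_minus field_simps)
qed

lemma arock_H1_eq:
  "arock_H1 r c q m n = inverse (1 + inverse c * real m powr (q - 1/2) * 3 + 2 / arock_H2 r c q m n)"
  unfolding two_over_arock_H2 arock_H1_def by (simp add: algebra_simps)

lemma arock_H1_pos: "0 < arock_H1 r c q m n"
  unfolding arock_H1_eq using c arock_H2_pos[of n]
  by (intro positive_imp_inverse_positive add_pos_nonneg) auto

lemma arock_H1_le_1: "arock_H1 r c q m n \<le> 1"
proof -
  have "0 \<le> inverse c * real m powr (q - 1/2) * 3 + 2 / arock_H2 r c q m n"
    using c arock_H2_pos[of n] by (intro add_nonneg_nonneg) auto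
  then show ?thesis
    unfolding arock_H1_eq by (intro inverse_le_1_iff[THEN iffD2]) linarith
qed

lemma arock_H1_le_H2_half: "arock_H1 r c q m n \<le> arock_H2 r c q m n / 2"
proof -
  have "0 \<le> inverse c * real m powr (q - 1/2) * 3" "0 < 2 / arock_H2 r c q m n"
    using c arock_H2_pos[of n] by auto
  then have "arock_H1 r c q m n \<le> inverse (2 / arock_H2 r c q m n)"
    unfolding arock_H1_eq by (intro le_imp_inverse_le) linarith+
  then show ?thesis
    by (simp add: field_simps)
qed

text \<open>
  The constant 3 in \<open>H\<^sub>1\<close> comes from here: \<open>c\<^sub>1/m = c\<^sup>-\<^sup>1 m\<^bsup>q-1/2\<^esup> (1 + 2 (1 - r\<^sup>2)) \<gamma>\<close>, and the last two
  factors are at most 3 and 1.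
\<close>

lemma step_size_admissible:
  assumes "0 \<le> \<eta>" "\<eta> \<le> arock_H1 r c q m n"
  shows "\<eta> * (1 + arock_coeff r c q m 1 / real m + 2 / arock_H2 r c q m n) \<le> 1"
proof -
  have r2: "0 < r\<^sup>2" "r\<^sup>2 < 1"
    using r by (auto simp: power_less_one_iff)
  have \<rho>: "0 < arock_rho r m"
    using arock_rho_bounds[OF r m] by simp
  have pw: "real m powr (1/2) / (real m * real m powr (- q)) = real m powr (q - 1/2)"
  proof -
    have "real m * real m powr (- q) = real m powr (1 - q)"
      using m by (simp add: powr_mult_base)
    then show ?thesis
      by (simp flip: powr_diff)
  qed
  have "arock_coeff r c q m 1 / real m
      = inverse c * (real m powr (1/2) / (real m * real m powr (- q))) * ((1 + 2 * (1 - r\<^sup>2)) * arock_gamma r c q m)"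
    unfolding arock_coeff_eq using \<rho> c by (simp add: divide_simps)
  also have "\<dots> \<le> inverse c * real m powr (q - 1/2) * (3 * 1)"
    unfolding pw using r2 c \<gamma>_pos arock_gamma_le_1
    by (intro mult_left_mono mult_mono) auto
  finally have "1 + arock_coeff r c q m 1 / real m + 2 / arock_H2 r c q m n \<le> inverse (arock_H1 r c q m n)"
    unfolding arock_H1_eq by simp
  then have "\<eta> * (1 + arock_coeff r c q m 1 / real m + 2 / arock_H2 r c q m n)
      \<le> arock_H1 r c q m n * inverse (arock_H1 r c q m n)"
    by (intro mult_mono' assms) (use assms arock_coeff_nonneg[of 1] arock_H2_pos[of n] in \<open>auto intro!: add_nonneg_nonneg\<close>)
  then show ?thesis
    using arock_H1_pos[of n] by simp
qed

text \<open>
  From \<open>1 - R \<le> \<eta>/m\<close> and \<open>\<eta> \<le> H\<^sub>1 \<le> H\<^sub>2/2\<close>. The gap \<open>1 - \<gamma>/\<rho>\<close> between consecutive coefficients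
  retains at least this much once the delay error has been paid for.
\<close>

lemma one_minus_arock_R_le:
  assumes "0 \<le> \<eta>" "\<eta> \<le> arock_H1 r c q m n"
  shows "1 - arock_R r m \<eta> (arock_H2 r c q m n) \<le> c * real m powr (- q) * arock_gamma r c q m ^ n"
proof -
  have r2: "0 < r\<^sup>2" "r\<^sup>2 < 1"
    using r by (auto simp: power_less_one_iff)
  have "1 - arock_R r m \<eta> (arock_H2 r c q m n) = \<eta> / real m * ((1 - r\<^sup>2) * (1 - \<eta> / arock_H2 r c q m n))"
    by (simp add: arock_R_def)
  also have "\<dots> \<le> \<eta> / real m * (1 * 1)"
    using assms r2 arock_H2_pos[of n] arock_H1_le_H2_half[of n]
    by (intro mult_left_mono mult_mono) (auto simp: field_simps)
  also have "\<dots> \<le> arock_H2 r c q m n / 2 / real m"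
    using order_trans[OF assms(2) arock_H1_le_H2_half] by (simp only: mult_1_right) (rule divide_right_mono, auto)
  also have "\<dots> = real m powr (1/2 - q) / real m * (c * arock_gamma r c q m ^ n)"
    by (simp add: arock_H2_def)
  also have "real m powr (1/2 - q) / real m = real m powr (- 1/2) * real m powr (- q)"
    using m by (simp add: powr_diff powr_minus field_simps powr_half_sqrt flip: powr_add)
  also have "\<dots> * (c * arock_gamma r c q m ^ n) \<le> (1 * real m powr (- q)) * (c * arock_gamma r c q m ^ n)"
    using m c \<gamma>_pos powr_mono[of "- 1/2" 0 "real m"] by (intro mult_right_mono) auto
  finally show ?thesis
    by (simp add: mult_ac)
qed

lemma sum_rho_gamma_powers:
  "(\<Sum>l<n. (arock_rho r m / arock_gamma r c q m) ^ Suc l)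
     = ((arock_rho r m / arock_gamma r c q m) ^ n - 1) * arock_rho r m / (c * real m powr (- q))"
proof -
  let ?\<rho> = "arock_rho r m" and ?\<gamma> = "arock_gamma r c q m"
  have \<rho>: "0 < ?\<rho>" and lt: "?\<gamma> < ?\<rho>"
    using arock_rho_bounds[OF r m] arock_gamma_less_rho by auto
  have "(\<Sum>l<n. (?\<rho> / ?\<gamma>) ^ Suc l) = (?\<rho> / ?\<gamma>) * (((?\<rho> / ?\<gamma>) ^ n - 1) / (?\<rho> / ?\<gamma> - 1))"
    unfolding power_Suc sum_distrib_left[symmetric]
    using geometric_sum[of "?\<rho> / ?\<gamma>" n] lt \<gamma>_pos by simp
  also have "\<dots> = ((?\<rho> / ?\<gamma>) ^ n - 1) * ?\<rho> / (?\<rho> - ?\<gamma>)"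
    using lt \<gamma>_pos by (simp add: divide_simps)
  also have "?\<rho> - ?\<gamma> = c * real m powr (- q)"
    by (simp add: arock_gamma_def)
  finally show ?thesis .
qed

text \<open>
  Let \<open>t = c m\<^bsup>-q\<^esup> = \<rho> - \<gamma>\<close>. Summing the geometric series of the weights turns the delay term into
  \<open>c\<^bsub>l+1\<^esub>\<close> times \<open>t (\<rho>\<^sup>n - \<gamma>\<^sup>n)\<close>, where the factor \<open>\<gamma>\<^sup>n\<close> of \<open>H\<^sub>2\<close> has cancelled the growth of the weights. After division
  by \<open>c\<^bsub>l+1\<^esub>\<close> the claim is \<open>\<gamma>/\<rho> + t (\<rho>\<^sup>n - \<gamma>\<^sup>n) \<le> R\<close>, which holds as \<open>1 - \<gamma>/\<rho> = t/\<rho> \<ge> t \<rho>\<^sup>n\<close> and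
  \<open>1 - R \<le> t \<gamma>\<^sup>n\<close>.
\<close>

lemma arock_coeff_absorbs_delay_error:
  assumes "0 \<le> \<eta>" "\<eta> \<le> arock_H1 r c q m n"
  shows "arock_coeff r c q m (Suc (Suc l))
      + (1/2 + (1 - r\<^sup>2)) * arock_H2 r c q m n
        * (\<Sum>l<n. (arock_rho r m / arock_gamma r c q m) ^ Suc l) / (arock_rho r m / arock_gamma r c q m) ^ Suc l
    \<le> arock_R r m \<eta> (arock_H2 r c q m n) * arock_coeff r c q m (Suc l)"
proof -
  let ?\<rho> = "arock_rho r m" and ?\<gamma> = "arock_gamma r c q m" and ?t = "c * real m powr (- q)"
  let ?K = "real m powr (1/2) * (1 + 2 * (1 - r\<^sup>2)) * ?\<rho> / ?t * (?\<gamma> / ?\<rho>) ^ Suc l"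
  have \<rho>: "0 < ?\<rho>" "?\<rho> \<le> 1" and t: "0 < ?t"
    using arock_rho_bounds[OF r m] c m by auto
  have H2: "(1/2 + (1 - r\<^sup>2)) * arock_H2 r c q m n = real m powr (1/2) * (1 + 2 * (1 - r\<^sup>2)) * ?t * ?\<gamma> ^ n"
  proof -
    have "real m powr (1/2 - q) = real m powr (1/2) * real m powr (- q)"
      by (simp flip: powr_add)
    then show ?thesis
      unfolding arock_H2_def by (simp add: algebra_simps)
  qed
  have powers: "?\<gamma> ^ n * ((?\<rho> / ?\<gamma>) ^ n - 1) = ?\<rho> ^ n - ?\<gamma> ^ n"
    using \<gamma>_pos by (simp add: power_divide right_diff_distrib)
  have inv: "inverse ((?\<rho> / ?\<gamma>) ^ Suc l) = (?\<gamma> / ?\<rho>) ^ Suc l"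
    by (simp only: power_inverse[symmetric] inverse_divide)
  have assoc: "a * b * g * (p * \<rho> / b) / d = a * \<rho> / b * inverse d * (b * (g * p))" for a b g p \<rho> d :: real
    by (simp only: divide_inverse mult_ac)
  have pen: "(1/2 + (1 - r\<^sup>2)) * arock_H2 r c q m n
      * (\<Sum>l<n. (?\<rho> / ?\<gamma>) ^ Suc l) / (?\<rho> / ?\<gamma>) ^ Suc l = ?K * (?t * (?\<rho> ^ n - ?\<gamma> ^ n))"
    unfolding H2 sum_rho_gamma_powers assoc powers inv ..
  have "0 \<le> ?K"
    using arock_coeff_nonneg[of "Suc l"] unfolding arock_coeff_eq .
  moreover have "?\<gamma> / ?\<rho> + ?t * (?\<rho> ^ n - ?\<gamma> ^ n) \<le> arock_R r m \<eta> (arock_H2 r c q m n)"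
  proof -
    have "?\<rho> ^ n \<le> 1" "1 \<le> 1 / ?\<rho>"
      using \<rho> by (simp_all add: power_le_one)
    then have "?t * ?\<rho> ^ n \<le> ?t * (1 / ?\<rho>)"
      using t by (intro mult_left_mono) linarith+
    moreover have "1 - ?\<gamma> / ?\<rho> = ?t * (1 / ?\<rho>)"
      using one_minus_gamma_rho by simp
    ultimately show ?thesis
      using one_minus_arock_R_le[OF assms] right_diff_distrib[of ?t "?\<rho> ^ n" "?\<gamma> ^ n"] by linarith
  qed
  ultimately have "?K * (?\<gamma> / ?\<rho> + ?t * (?\<rho> ^ n - ?\<gamma> ^ n)) \<le> ?K * arock_R r m \<eta> (arock_H2 r c q m n)"
    by (rule mult_left_mono[rotated])
  moreover have "arock_coeff r c q m (Suc l) = ?K" "arock_coeff r c q m (Suc (Suc l)) = ?K * (?\<gamma> / ?\<rho>)"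
    unfolding arock_coeff_eq by (simp_all only: power_Suc mult_ac)
  ultimately show ?thesis
    unfolding pen
    by (simp only: distrib_left[of ?K] mult.commute[of "arock_R r m \<eta> (arock_H2 r c q m n)"])
qed

end

section \<open>Square integrable vectors\<close>

definition square_integrable :: "'w measure \<Rightarrow> ('w \<Rightarrow> 'h::{real_inner, second_countable_topology}) \<Rightarrow> bool" where
  "square_integrable M f \<longleftrightarrow> f \<in> borel_measurable M \<and> integrable M (\<lambda>\<omega>. (norm (f \<omega>))\<^sup>2)"

lemma square_integrable_measurable [measurable_dest]:
  "square_integrable M f \<Longrightarrow> f \<in> borel_measurable M"
  by (simp add: square_integrable_def)

lemma square_integrable_norm2:
  "square_integrable M f \<Longrightarrow> integrable M (\<lambda>\<omega>. (norm (f \<omega>))\<^sup>2)"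
  by (simp add: square_integrable_def)

lemma square_integrable_bound:
  fixes f :: "'w \<Rightarrow> 'h::{real_inner, second_countable_topology}"
    and g :: "'w \<Rightarrow> 'k::{real_inner, second_countable_topology}"
  assumes f: "square_integrable M f" and g: "g \<in> borel_measurable M"
    and le: "\<And>\<omega>. \<omega> \<in> space M \<Longrightarrow> norm (g \<omega>) \<le> K * norm (f \<omega>)"
  shows "square_integrable M g"
  unfolding square_integrable_def
proof (rule conjI[OF g Bochner_Integration.integrable_bound])
  show "integrable M (\<lambda>\<omega>. K\<^sup>2 * (norm (f \<omega>))\<^sup>2)"
    using square_integrable_norm2[OF f] by simp
  show "AE \<omega> in M. norm ((norm (g \<omega>))\<^sup>2) \<le> norm (K\<^sup>2 * (norm (f \<omega>))\<^sup>2)"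
    unfolding power_mult_distrib[symmetric] using le
    by (intro AE_I2) (simp only: real_norm_def abs_power2, rule power_mono, simp_all)
qed (use g in measurable)

lemma square_integrable_add:
  assumes f: "square_integrable M f" and g: "square_integrable M g"
  shows "square_integrable M (\<lambda>\<omega>. f \<omega> + g \<omega>)"
  unfolding square_integrable_def
proof (rule conjI[OF _ Bochner_Integration.integrable_bound])
  note [measurable] = square_integrable_measurable[OF f] square_integrable_measurable[OF g]
  show "(\<lambda>\<omega>. f \<omega> + g \<omega>) \<in> borel_measurable M" "(\<lambda>\<omega>. (norm (f \<omega> + g \<omega>))\<^sup>2) \<in> borel_measurable M"
    by measurable
  show "integrable M (\<lambda>\<omega>. 2 * (norm (f \<omega>))\<^sup>2 + 2 * (norm (g \<omega>))\<^sup>2)"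
    using square_integrable_norm2[OF f] square_integrable_norm2[OF g] by simp
  have "(norm (a + b))\<^sup>2 \<le> 2 * (norm a)\<^sup>2 + 2 * (norm b)\<^sup>2" for a b :: 'b
  proof -
    have "(norm (a + b))\<^sup>2 \<le> (norm a + norm b)\<^sup>2"
      by (intro power_mono norm_triangle_ineq) simp
    also have "\<dots> \<le> 2 * (norm a)\<^sup>2 + 2 * (norm b)\<^sup>2"
      using sum_squares_bound[of "norm a" "norm b"] by (simp add: power2_sum)
    finally show ?thesis .
  qed
  then show "AE \<omega> in M. norm ((norm (f \<omega> + g \<omega>))\<^sup>2) \<le> norm (2 * (norm (f \<omega>))\<^sup>2 + 2 * (norm (g \<omega>))\<^sup>2)"
    by (intro AE_I2) (simp add: abs_of_nonneg)
qed

lemma square_integrable_diff: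
  assumes f: "square_integrable M f" and g: "square_integrable M g"
  shows "square_integrable M (\<lambda>\<omega>. f \<omega> - g \<omega>)"
proof -
  have "square_integrable M (\<lambda>\<omega>. - g \<omega>)"
    using g by (simp add: square_integrable_def)
  from square_integrable_add[OF f this] show ?thesis
    by simp
qed

lemma square_integrable_sum:
  assumes "finite I" and "\<And>i. i \<in> I \<Longrightarrow> square_integrable M (f i)"
  shows "square_integrable M (\<lambda>\<omega>. \<Sum>i\<in>I. f i \<omega>)"
  using assms
proof (induction I)
  case empty
  show ?case by (simp add: square_integrable_def)
next
  case (insert i I)
  then show ?case by (simp add: square_integrable_add)
qed

lemma square_integrable_inner:
  assumes f: "square_integrable M f" and g: "square_integrable M g"
  shows "integrable M (\<lambda>\<omega>. inner (f \<omega>) (g \<omega>))"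
proof (rule Bochner_Integration.integrable_bound)
  note [measurable] = square_integrable_measurable[OF f] square_integrable_measurable[OF g]
  show "(\<lambda>\<omega>. inner (f \<omega>) (g \<omega>)) \<in> borel_measurable M"
    by measurable
  show "integrable M (\<lambda>\<omega>. (norm (f \<omega>))\<^sup>2 + (norm (g \<omega>))\<^sup>2)"
    using square_integrable_norm2[OF f] square_integrable_norm2[OF g] by simp
  have "\<bar>inner a b\<bar> \<le> (norm a)\<^sup>2 + (norm b)\<^sup>2" for a b :: 'b
  proof -
    have "\<bar>inner a b\<bar> \<le> norm a * norm b"
      by (rule Cauchy_Schwarz_ineq2)
    also have "\<dots> \<le> 2 * norm a * norm b"
      by simp
    also have "\<dots> \<le> (norm a)\<^sup>2 + (norm b)\<^sup>2"
      by (rule sum_squares_bound)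
    finally show ?thesis .
  qed
  then show "AE \<omega> in M. norm (inner (f \<omega>) (g \<omega>)) \<le> norm ((norm (f \<omega>))\<^sup>2 + (norm (g \<omega>))\<^sup>2)"
    by (intro AE_I2) (simp add: abs_of_nonneg)
qed

section \<open>Conditional expectation over the random block\<close>

text \<open>
  The indicator of an event independent of \<open>F\<close> has constant conditional expectation, and an
  \<open>F\<close>-measurable factor can be pulled out.
\<close>

lemma (in prob_space) real_cond_exp_indep_indicator:
  fixes g :: "'a \<Rightarrow> real"
  assumes sub: "subalgebra M F" and B: "B \<in> events"
    and indep: "\<And>A. A \<in> sets F \<Longrightarrow> prob (B \<inter> A) = prob B * prob A"
    and g: "g \<in> borel_measurable F" and int: "integrable M (\<lambda>\<omega>. g \<omega> * indicator B \<omega>)"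
  shows "AE \<omega> in M. real_cond_exp M F (\<lambda>\<omega>. g \<omega> * indicator B \<omega>) \<omega> = g \<omega> * prob B"
proof -
  interpret F: finite_measure_subalgebra M F
    by unfold_locales (rule sub)
  have "AE \<omega> in M. real_cond_exp M F (indicator B) \<omega> = prob B"
  proof (rule F.real_cond_exp_charact)
    fix A assume A: "A \<in> sets F"
    then have A': "A \<in> events"
      using sub by (auto simp: subalgebra_def)
    have "(\<integral>\<omega>\<in>A. indicator B \<omega> \<partial>M) = prob (B \<inter> A)"
      using A' B by (simp add: set_lebesgue_integral_def Int_commute flip: indicator_inter_arith)
    also have "\<dots> = (\<integral>\<omega>\<in>A. prob B \<partial>M)"
      using A' indep[OF A] by (simp add: set_lebesgue_integral_def)
    finally show "(\<integral>\<omega>\<in>A. indicator B \<omega> \<partial>M) = (\<integral>\<omega>\<in>A. prob B \<partial>M)" .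
  qed (use B in \<open>auto simp: integrable_real_indicator emeasure_eq_measure\<close>)
  moreover have "AE \<omega> in M. real_cond_exp M F (\<lambda>\<omega>. g \<omega> * indicator B \<omega>) \<omega> = g \<omega> * real_cond_exp M F (indicator B) \<omega>"
    by (rule F.real_cond_exp_mult[OF g _ int]) (use B in measurable)
  ultimately show ?thesis
    by eventually_elim simp
qed

text \<open>
  A random index independent of \<open>F\<close> selects one of finitely many \<open>F\<close>-measurable quantities;
  \<open>B i\<close> is the event that index \<open>i\<close> is selected. Conditionally on \<open>F\<close> the selection averages out.
\<close>

lemma (in prob_space) real_cond_exp_independent_choice:
  fixes g :: "'i \<Rightarrow> 'a \<Rightarrow> real"
  assumes sub: "subalgebra M F" and fin: "finite I" and B: "\<And>i. i \<in> I \<Longrightarrow> B i \<in> events"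
    and indep: "\<And>i A. i \<in> I \<Longrightarrow> A \<in> sets F \<Longrightarrow> prob (B i \<inter> A) = prob (B i) * prob A"
    and g: "\<And>i. i \<in> I \<Longrightarrow> g i \<in> borel_measurable F" and int: "\<And>i. i \<in> I \<Longrightarrow> integrable M (g i)"
  shows "AE \<omega> in M. real_cond_exp M F (\<lambda>\<omega>. \<Sum>i\<in>I. g i \<omega> * indicator (B i) \<omega>) \<omega> = (\<Sum>i\<in>I. g i \<omega> * prob (B i))"
  using fin B indep g int
proof (induction I)
  case empty
  interpret F: finite_measure_subalgebra M F
    by unfold_locales (rule sub)
  show ?case
    using F.real_cond_exp_F_meas[of "\<lambda>_. 0"] by simp
next
  case (insert i I)
  interpret F: finite_measure_subalgebra M F
    by unfold_locales (rule sub)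
  have summand: "integrable M (\<lambda>\<omega>. g l \<omega> * indicator (B l) \<omega>)" if "l \<in> insert i I" for l
    using insert.prems that by (intro integrable_real_mult_indicator) auto
  have "AE \<omega> in M. real_cond_exp M F (\<lambda>\<omega>. g i \<omega> * indicator (B i) \<omega> + (\<Sum>i\<in>I. g i \<omega> * indicator (B i) \<omega>)) \<omega>
      = real_cond_exp M F (\<lambda>\<omega>. g i \<omega> * indicator (B i) \<omega>) \<omega>
        + real_cond_exp M F (\<lambda>\<omega>. \<Sum>i\<in>I. g i \<omega> * indicator (B i) \<omega>) \<omega>"
    using summand by (intro F.real_cond_exp_add Bochner_Integration.integrable_sum) auto
  moreover have "AE \<omega> in M. real_cond_exp M F (\<lambda>\<omega>. g i \<omega> * indicator (B i) \<omega>) \<omega> = g i \<omega> * prob (B i)"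
    using insert.prems summand by (intro real_cond_exp_indep_indicator sub) auto
  moreover have "AE \<omega> in M. real_cond_exp M F (\<lambda>\<omega>. \<Sum>i\<in>I. g i \<omega> * indicator (B i) \<omega>) \<omega> = (\<Sum>i\<in>I. g i \<omega> * prob (B i))"
    using insert.prems by (intro insert.IH) auto
  ultimately show ?case
    unfolding sum.insert[OF insert.hyps] by eventually_elim simp
qed

section \<open>The iteration pathwise\<close>

lemma arock_xi_eq:
  "arock_xi r c q m xstar x k \<omega> = (norm (x k \<omega> - xstar))\<^sup>2
     + 1 / real m * (\<Sum>n<k. arock_coeff r c q m (Suc n) * (norm (x (k - n) \<omega> - x (k - Suc n) \<omega>))\<^sup>2)"
proof -
  have "(\<Sum>n. arock_coeff r c q m (Suc n) * (norm (x (k + 1 - Suc n) \<omega> - x (k - Suc n) \<omega>))\<^sup>2)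
      = (\<Sum>n<k. arock_coeff r c q m (Suc n) * (norm (x (k + 1 - Suc n) \<omega> - x (k - Suc n) \<omega>))\<^sup>2)"
    by (rule suminf_finite) auto
  then show ?thesis
    by (simp add: arock_xi_def)
qed

context arock
begin

definition residual :: "nat \<Rightarrow> 'w \<Rightarrow> 'h" where
  "residual k \<omega> = delayed_iterate m V j x k \<omega> - T (delayed_iterate m V j x k \<omega>)"

definition increment :: "nat \<Rightarrow> nat \<Rightarrow> 'w \<Rightarrow> 'h" where
  "increment k n \<omega> = x (k - n) \<omega> - x (k - Suc n) \<omega>"

text \<open>
  The increase of the Lyapunov function caused by the update if block \<open>i\<close> is selected, apart from the
  shift of the older increments. With \<open>\<kappa> = c\<^sub>1/m\<close> it accounts for the distance to \<open>x\<^sup>*\<close> and for the newest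
  increment.
\<close>

definition block_gain :: "real \<Rightarrow> nat \<Rightarrow> 'w \<Rightarrow> nat \<Rightarrow> real" where
  "block_gain \<kappa> k \<omega> i = (\<eta> k \<omega>)\<^sup>2 * (1 + \<kappa>) * (norm (block m V (residual k \<omega>) i))\<^sup>2
     - 2 * \<eta> k \<omega> * inner (x k \<omega> - xstar) (block m V (residual k \<omega>) i)"

lemma blk_measurable: "blk k \<in> measurable M (count_space {1..m})"
  using blk_indep unfolding indep_vars_def2 by auto

lemma blk_mem: "\<omega> \<in> space M \<Longrightarrow> blk k \<omega> \<in> {1..m}"
  using measurable_space[OF blk_measurable, of \<omega> k] by simp

lemma blk_event: "{\<omega> \<in> space M. blk k \<omega> = i} \<in> events"
proof -
  have "{\<omega> \<in> space M. blk k \<omega> = i} = blk k -` ({i} \<inter> {1..m}) \<inter> space M"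
    using blk_mem[of _ k] by auto
  then show ?thesis
    using measurable_sets[OF blk_measurable, of "{i} \<inter> {1..m}" k] by simp
qed

lemma prob_blk:
  assumes "i \<in> {1..m}"
  shows "prob {\<omega> \<in> space M. blk k \<omega> = i} = 1 / real m"
proof -
  have "prob {\<omega> \<in> space M. blk k \<omega> = i} = measure (distr M (count_space {1..m}) (blk k)) {i}"
    using assms by (subst measure_distr[OF blk_measurable]) (auto intro!: arg_cong[where f = prob])
  also have "\<dots> = 1 / real m"
    unfolding blk_uniform using assms m_pos by (subst measure_uniform_count_measure) auto
  finally show ?thesis .
qed

lemma update:
  assumes "\<omega> \<in> space M"
  shows "x (Suc k) \<omega> = x k \<omega> - \<eta> k \<omega> *\<^sub>R block m V (residual k \<omega>) (blk k \<omega>)"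
proof -
  have "x (Suc k) \<omega> = (\<Sum>i=1..m. block m V (x (Suc k) \<omega>) i)"
    by (simp add: block_sum[OF decomposition])
  also have "\<dots> = (\<Sum>i=1..m. block m V (x k \<omega>) i
      - (if i = blk k \<omega> then \<eta> k \<omega> *\<^sub>R block m V (residual k \<omega>) (blk k \<omega>) else 0))"
    by (intro sum.cong refl) (simp add: step[OF assms] residual_def)
  also have "\<dots> = x k \<omega> - \<eta> k \<omega> *\<^sub>R block m V (residual k \<omega>) (blk k \<omega>)"
    using blk_mem[OF assms, of k] by (simp add: sum_subtractf block_sum[OF decomposition])
  finally show ?thesis .
qed

lemma T_contracts: "norm (T y - xstar) \<le> r * norm (y - xstar)"
  using lipschitz_onD[OF lipschitz, of y xstar] by (simp add: fixed_point dist_norm)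

text \<open>
  All summands but the last are determined by the past; the block chosen at step \<open>k\<close> enters through the
  indicators alone. This is the form to which conditional expectation applies.
\<close>

lemma arock_xi_Suc:
  assumes \<omega>: "\<omega> \<in> space M"
  shows "arock_xi r c q m xstar x (Suc k) \<omega> =
    ((norm (x k \<omega> - xstar))\<^sup>2 + 1 / real m * (\<Sum>n<k. arock_coeff r c q m (Suc (Suc n)) * (norm (increment k n \<omega>))\<^sup>2))
    + (\<Sum>i=1..m. block_gain (arock_coeff r c q m 1 / real m) k \<omega> i * indicator {\<omega> \<in> space M. blk k \<omega> = i} \<omega>)"
proof -
  define p where "p = block m V (residual k \<omega>) (blk k \<omega>)"
  have "(\<Sum>i=1..m. block_gain (arock_coeff r c q m 1 / real m) k \<omega> i * indicator {\<omega> \<in> space M. blk k \<omega> = i} \<omega>)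
      = (\<Sum>i=1..m. if i = blk k \<omega> then block_gain (arock_coeff r c q m 1 / real m) k \<omega> i else 0)"
    by (intro sum.cong refl) (use \<omega> in \<open>auto simp: indicator_def\<close>)
  also have "\<dots> = block_gain (arock_coeff r c q m 1 / real m) k \<omega> (blk k \<omega>)"
    using blk_mem[OF \<omega>, of k] by simp
  finally have gain: "(\<Sum>i=1..m. block_gain (arock_coeff r c q m 1 / real m) k \<omega> i * indicator {\<omega> \<in> space M. blk k \<omega> = i} \<omega>)
      = (\<eta> k \<omega>)\<^sup>2 * (1 + arock_coeff r c q m 1 / real m) * (norm p)\<^sup>2 - 2 * \<eta> k \<omega> * inner (x k \<omega> - xstar) p"
    by (simp add: block_gain_def p_def)
  have "(norm (x (Suc k) \<omega> - xstar))\<^sup>2 = (norm ((x k \<omega> - xstar) - \<eta> k \<omega> *\<^sub>R p))\<^sup>2"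
    by (simp add: update[OF \<omega>] p_def algebra_simps)
  also have "\<dots> = (norm (x k \<omega> - xstar))\<^sup>2 - 2 * \<eta> k \<omega> * inner (x k \<omega> - xstar) p + (\<eta> k \<omega>)\<^sup>2 * (norm p)\<^sup>2"
    unfolding power2_norm_eq_inner by (simp add: algebra_simps inner_commute power2_eq_square)
  finally have dist: "(norm (x (Suc k) \<omega> - xstar))\<^sup>2
      = (norm (x k \<omega> - xstar))\<^sup>2 - 2 * \<eta> k \<omega> * inner (x k \<omega> - xstar) p + (\<eta> k \<omega>)\<^sup>2 * (norm p)\<^sup>2" .
  have incr: "(norm (x (Suc k) \<omega> - x k \<omega>))\<^sup>2 = (\<eta> k \<omega>)\<^sup>2 * (norm p)\<^sup>2"
    by (simp add: update[OF \<omega>] p_def power_mult_distrib)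
  show ?thesis
    unfolding gain arock_xi_eq sum.lessThan_Suc_shift increment_def
    by (simp add: dist incr One_nat_def[symmetric] algebra_simps)
qed

lemma sum_block_gain:
  "(\<Sum>i=1..m. block_gain \<kappa> k \<omega> i)
     = (\<eta> k \<omega>)\<^sup>2 * (1 + \<kappa>) * (norm (residual k \<omega>))\<^sup>2 - 2 * \<eta> k \<omega> * inner (x k \<omega> - xstar) (residual k \<omega>)"
  unfolding block_gain_def sum_subtractf sum_distrib_left[symmetric] inner_sum_right[symmetric]
    norm_block_sum[OF decomposition] block_sum[OF decomposition] ..

text \<open>
  The left-hand side is the Lyapunov function after step \<open>k\<close> with the indicators replaced by their mean
  \<open>1/m\<close>. The three estimates combine pathwise: the averaged descent, the bound on the delay error with weights
  \<open>(\<rho>/\<gamma>)\<^bsup>l+1\<^esup>\<close>, and the absorption of the delay error by the coefficients.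
\<close>

lemma averaged_lyapunov_descent:
  assumes r: "0 < r" "r < 1" and c: "0 < c" and \<gamma>: "0 < arock_gamma r c q m"
    and \<eta>: "0 \<le> \<eta> k \<omega>" "\<eta> k \<omega> \<le> arock_H1 r c q m (current_delay m j k)"
  shows "((norm (x k \<omega> - xstar))\<^sup>2 + 1 / real m * (\<Sum>n<k. arock_coeff r c q m (Suc (Suc n)) * (norm (increment k n \<omega>))\<^sup>2))
      + (\<Sum>i=1..m. block_gain (arock_coeff r c q m 1 / real m) k \<omega> i * (1 / real m))
    \<le> arock_R r m (\<eta> k \<omega>) (arock_H2 r c q m (current_delay m j k)) * arock_xi r c q m xstar x k \<omega>"
proof -
  note hyps = r c m_pos \<gamma>
  let ?J = "current_delay m j k"
  let ?\<theta> = "arock_H2 r c q m ?J" and ?s = "1 - r\<^sup>2" and ?\<kappa> = "arock_coeff r c q m 1 / real m"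
  let ?R = "arock_R r m (\<eta> k \<omega>) ?\<theta>"
  let ?a = "\<lambda>n. arock_coeff r c q m (Suc n)"
  define w where "w l = (arock_rho r m / arock_gamma r c q m) ^ Suc l" for l
  define z where "z = delayed_iterate m V j x k \<omega> - xstar"
  define u where "u = x k \<omega> - xstar"
  define D where "D n = (norm (increment k n \<omega>))\<^sup>2" for n
  have r2: "0 < r\<^sup>2" "r\<^sup>2 < 1"
    using r by (auto simp: power_less_one_iff)
  have w_pos: "0 < w l" for l
    unfolding w_def using arock_rho_bounds[OF r m_pos] \<gamma> by simp
  have "norm (z - residual k \<omega>) \<le> r * norm z"
    using T_contracts by (simp add: z_def residual_def)
  then have "(norm (z - residual k \<omega>))\<^sup>2 \<le> (r * norm z)\<^sup>2"
    by (intro power_mono) auto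
  then have contr: "(norm (z - residual k \<omega>))\<^sup>2 \<le> (1 - ?s) * (norm z)\<^sup>2"
    by (simp add: power_mult_distrib)
  have descent: "(\<eta> k \<omega>)\<^sup>2 * (1 + ?\<kappa>) * (norm (residual k \<omega>))\<^sup>2 - 2 * \<eta> k \<omega> * inner u (residual k \<omega>)
      \<le> (1/2 + ?s) * ?\<theta> * (norm (u - z))\<^sup>2 - \<eta> k \<omega> * ?s * (1 - \<eta> k \<omega> / ?\<theta>) * (norm u)\<^sup>2"
    by (rule averaged_step_descent[OF contr _ \<eta>(1) arock_H2_pos[OF hyps] step_size_admissible[OF hyps \<eta>]])
       (use r2 in simp)
  have "(norm (u - z))\<^sup>2 \<le> (\<Sum>l<?J. w l) * (\<Sum>l<k. D l / w l)"
    using delay_error_bound[OF decomposition w_pos, where x = x and k = k and \<omega> = \<omega> and j = j]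
    by (simp add: u_def z_def D_def increment_def)
  then have "(1/2 + ?s) * ?\<theta> * (norm (u - z))\<^sup>2 \<le> (1/2 + ?s) * ?\<theta> * ((\<Sum>l<?J. w l) * (\<Sum>l<k. D l / w l))"
    by (rule mult_left_mono) (use r2 arock_H2_pos[OF hyps, of ?J] in auto)
  also have "A * (B * (\<Sum>l<k. D l / w l)) = (\<Sum>l<k. A * B / w l * D l)" for A B
    by (simp add: sum_distrib_left mult_ac)
  finally have error: "(1/2 + ?s) * ?\<theta> * (norm (u - z))\<^sup>2
      \<le> (\<Sum>l<k. (1/2 + ?s) * ?\<theta> * (\<Sum>l<?J. w l) / w l * D l)" .
  have "(\<Sum>l<k. ?a (Suc l) * D l) + (\<Sum>l<k. (1/2 + ?s) * ?\<theta> * (\<Sum>l<?J. w l) / w l * D l) \<le> (\<Sum>l<k. ?R * ?a l * D l)"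
    unfolding sum.distrib[symmetric] distrib_right[symmetric]
    using arock_coeff_absorbs_delay_error[OF hyps \<eta>, folded w_def]
    by (intro sum_mono mult_right_mono) (auto simp: D_def)
  with descent error have "(\<Sum>l<k. ?a (Suc l) * D l) + (\<Sum>i=1..m. block_gain ?\<kappa> k \<omega> i)
      \<le> ?R * (\<Sum>l<k. ?a l * D l) - \<eta> k \<omega> * ?s * (1 - \<eta> k \<omega> / ?\<theta>) * (norm u)\<^sup>2"
    unfolding sum_block_gain u_def[symmetric] sum_distrib_left mult.assoc[of ?R] by linarith
  then have "(\<Sum>l<k. ?a (Suc l) * D l) / real m + (\<Sum>i=1..m. block_gain ?\<kappa> k \<omega> i) / real m
      \<le> (?R * (\<Sum>l<k. ?a l * D l) - \<eta> k \<omega> * ?s * (1 - \<eta> k \<omega> / ?\<theta>) * (norm u)\<^sup>2) / real m"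
    unfolding add_divide_distrib[symmetric] by (rule divide_right_mono) simp
  moreover have "?R * arock_xi r c q m xstar x k \<omega> = (norm u)\<^sup>2
      + (?R * (\<Sum>l<k. ?a l * D l) - \<eta> k \<omega> * ?s * (1 - \<eta> k \<omega> / ?\<theta>) * (norm u)\<^sup>2) / real m"
  proof -
    have "?R * arock_xi r c q m xstar x k \<omega> = ?R * (norm u)\<^sup>2 + ?R * (\<Sum>l<k. ?a l * D l) / real m"
      unfolding arock_xi_eq u_def D_def increment_def distrib_left by simp
    also have "?R * (norm u)\<^sup>2 = (norm u)\<^sup>2 - \<eta> k \<omega> * ?s * (1 - \<eta> k \<omega> / ?\<theta>) * (norm u)\<^sup>2 / real m"
      unfolding arock_R_def left_diff_distrib by simp
    finally show ?thesis
      by (simp add: diff_divide_distrib)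
  qed
  ultimately show ?thesis
    unfolding D_def[symmetric] u_def[symmetric] sum_distrib_right[symmetric] by simp
qed

section \<open>The filtrations\<close>

lemma generators_into_space: "(\<Union>l\<in>{..k}. sets (vimage_algebra (space M) (x l) borel)) \<subseteq> Pow (space M)"
  using sets.space_closed[of "vimage_algebra (space M) (x _) borel"] by auto

lemma space_filtration_G [simp]: "space (filtration_G M x k) = space M"
  unfolding filtration_G_def by (rule space_measure_of[OF generators_into_space])

lemma iterate_measurable_filtration_G:
  assumes "l \<le> k"
  shows "x l \<in> borel_measurable (filtration_G M x k)"
proof (rule measurableI)
  fix A :: "'h set" assume A: "A \<in> sets borel"
  have "x l -` A \<inter> space M \<in> sets (vimage_algebra (space M) (x l) borel)"
    using A by (rule in_vimage_algebra)
  then have "x l -` A \<inter> space M \<in> (\<Union>l\<in>{..k}. sets (vimage_algebra (space M) (x l) borel))"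
    using assms by blast
  then show "x l -` A \<inter> space (filtration_G M x k) \<in> sets (filtration_G M x k)"
    unfolding space_filtration_G unfolding filtration_G_def
    by (rule in_measure_of[OF generators_into_space])
qed simp

text \<open>
  Deterministic delays are constant functions, which generate only the trivial sigma-algebra. Therefore
  a step size adapted to the larger filtration, and independence of it, may be used with the smaller one.
\<close>

lemma sets_filtration_F: "sets (filtration_F M m j x k) = sets (filtration_G M x k)"
proof (rule antisym)
  let ?X = "\<Union>l\<in>{..k}. sets (vimage_algebra (space M) (x l) (borel :: 'h measure))"
  let ?Y = "\<Union>l\<in>{..k}. \<Union>i\<in>{1..m}. sets (vimage_algebra (space M) (\<lambda>_. j l i) (count_space UNIV))"
  have const: "(\<lambda>_. n) -` B \<inter> space M \<in> {{}, space M}" for n :: nat and B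
    by auto
  have Y: "?Y \<subseteq> {{}, space M}"
  proof
    fix A assume "A \<in> ?Y"
    then obtain l i where "A \<in> sets (vimage_algebra (space M) (\<lambda>_. j l i) (count_space UNIV))"
      by blast
    then obtain B where "A = (\<lambda>_. j l i) -` B \<inter> space M"
      using sets_vimage_algebra2[of "\<lambda>_. j l i" "space M" "count_space UNIV"] by auto
    then show "A \<in> {{}, space M}"
      using const by simp
  qed
  have F: "sets (filtration_F M m j x k) = sigma_sets (space M) (?X \<union> ?Y)"
    unfolding filtration_F_def
    by (rule sets_measure_of[OF Un_least[OF generators_into_space order_trans[OF Y]]]) auto
  have G: "sets (filtration_G M x k) = sigma_sets (space M) ?X"
    unfolding filtration_G_def by (rule sets_measure_of[OF generators_into_space])
  have "?Y \<subseteq> sigma_sets (space M) ?X"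
    using Y sigma_sets_top[of "space M" ?X] sigma_sets.Empty[of "space M" ?X] by auto
  then show "sets (filtration_F M m j x k) \<subseteq> sets (filtration_G M x k)"
    unfolding F G by (intro sigma_sets_mono) (auto intro: sigma_sets.Basic)
  show "sets (filtration_G M x k) \<subseteq> sets (filtration_F M m j x k)"
    unfolding F G by (intro sigma_sets_mono') auto
qed

lemma step_size_measurable_G: "\<eta> k \<in> borel_measurable (filtration_G M x k)"
  using step_size_measurable[of k] measurable_cong_sets[OF sets_filtration_F refl] by blast

lemma blk_indep_G:
  assumes "A \<in> sets (filtration_G M x k)"
  shows "prob ({\<omega> \<in> space M. blk k \<omega> = i} \<inter> A) = prob {\<omega> \<in> space M. blk k \<omega> = i} * prob A"
proof (rule indep_setD[OF blk_indep_F[of k]])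
  have "{\<omega> \<in> space M. blk k \<omega> = i} = blk k -` ({i} \<inter> {1..m}) \<inter> space M"
    using blk_mem[of _ k] by auto
  then show "{\<omega> \<in> space M. blk k \<omega> = i} \<in> sets (vimage_algebra (space M) (blk k) (count_space {1..m}))"
    by (simp only:) (rule in_vimage_algebra, simp)
  show "A \<in> sets (filtration_F M m j x k)"
    using assms by (simp add: sets_filtration_F)
qed

lemma block_measurable:
  assumes "i \<in> {1..m}" "f \<in> borel_measurable N"
  shows "(\<lambda>\<omega>. block m V (f \<omega>) i) \<in> borel_measurable N"
proof (rule measurable_compose[OF assms(2)])
  show "(\<lambda>y. block m V y i) \<in> borel_measurable borel"
    by (intro borel_measurable_continuous_onI linear_continuous_on bounded_linear_block[OF decomposition assms(1)])
qed

lemma residual_measurable: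
  assumes "\<And>l. l \<le> k \<Longrightarrow> x l \<in> borel_measurable N"
  shows "residual k \<in> borel_measurable N"
proof -
  have "delayed_iterate m V j x k \<in> borel_measurable N"
    unfolding delayed_iterate_def[abs_def]
    by (rule borel_measurable_sum, rule block_measurable) (auto intro: assms)
  moreover have "T \<in> borel_measurable borel"
    by (rule borel_measurable_continuous_onI[OF lipschitz_on_continuous_on[OF lipschitz]])
  ultimately show ?thesis
    unfolding residual_def[abs_def] by (intro borel_measurable_diff) (auto intro: measurable_compose)
qed

end

section \<open>Descent of the conditional expectation\<close>

context arock
begin

lemma subalgebra_filtration_G:
  assumes "\<And>l. l \<le> k \<Longrightarrow> x l \<in> borel_measurable M"
  shows "subalgebra M (filtration_G M x k)"
  unfolding subalgebra_def
proof (intro conjI space_filtration_G)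
  have "sets (vimage_algebra (space M) (x l) borel) \<subseteq> events" if "l \<le> k" for l
    using assms[OF that] by (simp add: sets_vimage_algebra2 measurable_def) (auto simp: measurable_def)
  then have "(\<Union>l\<in>{..k}. sets (vimage_algebra (space M) (x l) borel)) \<subseteq> events"
    by auto
  then show "sets (filtration_G M x k) \<subseteq> events"
    unfolding filtration_G_def sets_measure_of[OF generators_into_space] by (rule sets.sigma_sets_subset)
qed

text \<open>
  The recursion selects a block by a random index; as a finite sum over the blocks weighted by
  indicators the selection is visibly measurable.
\<close>

lemma iterate_measurable: "x k \<in> borel_measurable M"
proof (induction k rule: less_induct)
  case (less k)
  show ?case
  proof (cases k)
    case 0
    then show ?thesis by (simp add: start_measurable)
  next
    case (Suc n)
    then have x: "x l \<in> borel_measurable M" if "l \<le> n" for l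
      using less that by simp
    note [measurable] = x[OF order_refl] measurable_from_subalg[OF subalgebra_filtration_G[OF x] step_size_measurable_G]
      residual_measurable[OF x] blk_event
    have [measurable]: "(\<lambda>\<omega>. block m V (residual n \<omega>) i) \<in> borel_measurable M" if "i \<in> {1..m}" for i
      by (rule block_measurable[OF that residual_measurable[OF x]])
    have "(\<lambda>\<omega>. x n \<omega> - \<eta> n \<omega> *\<^sub>R
        (\<Sum>i=1..m. indicator {\<omega> \<in> space M. blk n \<omega> = i} \<omega> *\<^sub>R block m V (residual n \<omega>) i)) \<in> borel_measurable M"
      by measurable
    also have "?this \<longleftrightarrow> x (Suc n) \<in> borel_measurable M"
    proof (rule measurable_cong)
      fix \<omega> assume \<omega>: "\<omega> \<in> space M"
      have "(\<Sum>i=1..m. indicator {\<omega> \<in> space M. blk n \<omega> = i} \<omega> *\<^sub>R block m V (residual n \<omega>) i)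
          = (\<Sum>i=1..m. if i = blk n \<omega> then block m V (residual n \<omega>) (blk n \<omega>) else 0)"
        using \<omega> by (intro sum.cong) (auto simp: indicator_def)
      also have "\<dots> = block m V (residual n \<omega>) (blk n \<omega>)"
        using blk_mem[OF \<omega>, of n] by simp
      finally show "x n \<omega> - \<eta> n \<omega> *\<^sub>R
          (\<Sum>i=1..m. indicator {\<omega> \<in> space M. blk n \<omega> = i} \<omega> *\<^sub>R block m V (residual n \<omega>) i) = x (Suc n) \<omega>"
        by (simp add: update[OF \<omega>])
    qed
    finally show ?thesis
      using Suc by simp
  qed
qed

lemma subalgebra_G: "subalgebra M (filtration_G M x k)"
  by (rule subalgebra_filtration_G) (rule iterate_measurable)

text \<open>
  The residual is a Lipschitz function of the delayed iterate that vanishes at \<open>x\<^sup>*\<close>.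
\<close>

lemma residual_square_integrable:
  assumes x: "\<And>l. l \<le> k \<Longrightarrow> square_integrable M (\<lambda>\<omega>. x l \<omega> - xstar)"
  shows "square_integrable M (residual k)"
proof -
  let ?z = "\<lambda>\<omega>. \<Sum>i=1..m. block m V (x (k - j k i) \<omega> - xstar) i"
  have lin: "bounded_linear (\<lambda>y. block m V y i)" if "i \<in> {1..m}" for i
    by (rule bounded_linear_block[OF decomposition that])
  have z: "?z \<omega> = delayed_iterate m V j x k \<omega> - xstar" for \<omega>
  proof -
    have "?z \<omega> = (\<Sum>i=1..m. block m V (x (k - j k i) \<omega>) i) - (\<Sum>i=1..m. block m V xstar i)"
      unfolding sum_subtractf[symmetric]
      by (intro sum.cong refl) (simp add: linear_diff[OF bounded_linear.linear[OF lin]])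
    then show ?thesis
      by (simp add: delayed_iterate_def block_sum[OF decomposition])
  qed
  have "square_integrable M (\<lambda>\<omega>. block m V (x (k - j k i) \<omega> - xstar) i)" if i: "i \<in> {1..m}" for i
  proof (rule square_integrable_bound[where K = 1])
    show "square_integrable M (\<lambda>\<omega>. x (k - j k i) \<omega> - xstar)"
      by (rule x) simp
    then show "(\<lambda>\<omega>. block m V (x (k - j k i) \<omega> - xstar) i) \<in> borel_measurable M"
      by (rule block_measurable[OF i square_integrable_measurable])
  qed (simp add: norm_block_le[OF decomposition i])
  then have "square_integrable M ?z"
    by (intro square_integrable_sum) auto
  then show ?thesis
  proof (rule square_integrable_bound[where K = "1 + r"])
    show "residual k \<in> borel_measurable M"
      by (rule residual_measurable) (rule iterate_measurable)
    fix \<omega>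
    have "residual k \<omega> = ?z \<omega> - (T (delayed_iterate m V j x k \<omega>) - xstar)"
      by (simp add: residual_def z)
    then have "norm (residual k \<omega>) \<le> norm (?z \<omega>) + norm (T (delayed_iterate m V j x k \<omega>) - xstar)"
      by (simp only: norm_triangle_ineq4)
    also have "\<dots> \<le> (1 + r) * norm (?z \<omega>)"
      using T_contracts[of "delayed_iterate m V j x k \<omega>"] unfolding z by (simp add: distrib_right)
    finally show "norm (residual k \<omega>) \<le> (1 + r) * norm (?z \<omega>)" .
  qed
qed

context
  assumes step_size_bounds: "\<forall>k. \<forall>\<omega>\<in>space M. 0 \<le> \<eta> k \<omega> \<and> \<eta> k \<omega> \<le> 1"
begin

lemma iterate_square_integrable: "square_integrable M (\<lambda>\<omega>. x k \<omega> - xstar)"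
proof (induction k rule: less_induct)
  case (less k)
  show ?case
  proof (cases k)
    case 0
    have "square_integrable M (x 0)" "square_integrable M (\<lambda>_. xstar)"
      using start_measurable start_integrable by (simp_all add: square_integrable_def)
    from square_integrable_diff[OF this] show ?thesis
      by (simp add: 0)
  next
    case (Suc n)
    then have x: "square_integrable M (\<lambda>\<omega>. x l \<omega> - xstar)" if "l \<le> n" for l
      using less that by simp
    have "square_integrable M (\<lambda>\<omega>. x (Suc n) \<omega> - x n \<omega>)"
    proof (rule square_integrable_bound[OF residual_square_integrable[OF x], where K = 1])
      show "(\<lambda>\<omega>. x (Suc n) \<omega> - x n \<omega>) \<in> borel_measurable M"
        by (intro borel_measurable_diff iterate_measurable)
      fix \<omega> assume \<omega>: "\<omega> \<in> space M"
      have "\<bar>\<eta> n \<omega>\<bar> * norm (block m V (residual n \<omega>) (blk n \<omega>)) \<le> 1 * norm (residual n \<omega>)"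
        using step_size_bounds \<omega> norm_block_le[OF decomposition blk_mem[OF \<omega>], of "residual n \<omega>" n]
        by (intro mult_mono) auto
      then show "norm (x (Suc n) \<omega> - x n \<omega>) \<le> 1 * norm (residual n \<omega>)"
        by (simp add: update[OF \<omega>])
    qed
    from square_integrable_add[OF this x[OF order_refl]] show ?thesis
      by (simp add: Suc)
  qed
qed

lemma increment_square_integrable: "square_integrable M (increment k n)"
  unfolding increment_def[abs_def]
  using square_integrable_diff[OF iterate_square_integrable[of "k - n"] iterate_square_integrable[of "k - Suc n"]]
  by simp

lemma arock_xi_integrable: "integrable M (arock_xi r c q m xstar x k)"
  unfolding arock_xi_eq[abs_def] increment_def[symmetric]
  by (intro Bochner_Integration.integrable_add integrable_mult_right Bochner_Integration.integrable_sum
      square_integrable_norm2 iterate_square_integrable increment_square_integrable)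

lemma block_gain_integrable:
  assumes i: "i \<in> {1..m}"
  shows "integrable M (\<lambda>\<omega>. block_gain \<kappa> k \<omega> i)"
proof -
  let ?p = "\<lambda>\<omega>. \<eta> k \<omega> *\<^sub>R block m V (residual k \<omega>) i"
  have res: "residual k \<in> borel_measurable M"
    by (rule residual_measurable) (rule iterate_measurable)
  have "square_integrable M ?p"
  proof (rule square_integrable_bound[OF residual_square_integrable[OF iterate_square_integrable], where K = 1])
    show "?p \<in> borel_measurable M"
      by (rule borel_measurable_scaleR[OF measurable_from_subalg[OF subalgebra_G step_size_measurable_G]
        block_measurable[OF i res]])
    fix \<omega> assume \<omega>: "\<omega> \<in> space M"
    have "\<bar>\<eta> k \<omega>\<bar> * norm (block m V (residual k \<omega>) i) \<le> 1 * norm (residual k \<omega>)"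
      using step_size_bounds \<omega> norm_block_le[OF decomposition i, of "residual k \<omega>"]
      by (intro mult_mono) auto
    then show "norm (?p \<omega>) \<le> 1 * norm (residual k \<omega>)"
      by simp
  qed
  then have "integrable M (\<lambda>\<omega>. (1 + \<kappa>) * (norm (?p \<omega>))\<^sup>2 - 2 * inner (x k \<omega> - xstar) (?p \<omega>))"
    by (intro Bochner_Integration.integrable_diff integrable_mult_right square_integrable_norm2
      square_integrable_inner iterate_square_integrable)
  also have "(\<lambda>\<omega>. (1 + \<kappa>) * (norm (?p \<omega>))\<^sup>2 - 2 * inner (x k \<omega> - xstar) (?p \<omega>)) = (\<lambda>\<omega>. block_gain \<kappa> k \<omega> i)"
    by (simp add: block_gain_def power_mult_distrib mult_ac)
  finally show ?thesis .
qed

lemma cond_exp_arock_xi: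
  "AE \<omega> in M. real_cond_exp M (filtration_G M x k) (arock_xi r c q m xstar x (Suc k)) \<omega>
    = ((norm (x k \<omega> - xstar))\<^sup>2 + 1 / real m * (\<Sum>n<k. arock_coeff r c q m (Suc (Suc n)) * (norm (increment k n \<omega>))\<^sup>2))
      + (\<Sum>i=1..m. block_gain (arock_coeff r c q m 1 / real m) k \<omega> i * (1 / real m))"
proof -
  let ?G = "filtration_G M x k"
  let ?B = "\<lambda>i. {\<omega> \<in> space M. blk k \<omega> = i}"
  let ?g = "\<lambda>i \<omega>. block_gain (arock_coeff r c q m 1 / real m) k \<omega> i"
  let ?base = "\<lambda>\<omega>. (norm (x k \<omega> - xstar))\<^sup>2
    + 1 / real m * (\<Sum>n<k. arock_coeff r c q m (Suc (Suc n)) * (norm (increment k n \<omega>))\<^sup>2)"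
  let ?sum = "\<lambda>\<omega>. \<Sum>i=1..m. ?g i \<omega> * indicator (?B i) \<omega>"
  interpret G: finite_measure_subalgebra M ?G
    by unfold_locales (rule subalgebra_G)
  note xG = iterate_measurable_filtration_G
  have base_G: "?base \<in> borel_measurable ?G"
    unfolding increment_def
    by (intro borel_measurable_add borel_measurable_times borel_measurable_const borel_measurable_sum
      borel_measurable_power measurable_compose[OF _ borel_measurable_norm] borel_measurable_diff xG) auto
  have base_int: "integrable M ?base"
    by (intro Bochner_Integration.integrable_add integrable_mult_right Bochner_Integration.integrable_sum
      square_integrable_norm2 iterate_square_integrable increment_square_integrable)
  have resG: "residual k \<in> borel_measurable ?G"
    by (rule residual_measurable) (rule xG)
  have g_G: "?g i \<in> borel_measurable ?G" if "i \<in> {1..m}" for i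
  proof -
    have [measurable]: "(\<lambda>\<omega>. block m V (residual k \<omega>) i) \<in> borel_measurable ?G"
      by (rule block_measurable[OF that resG])
    note [measurable] = xG[OF order_refl] step_size_measurable_G
    show ?thesis
      unfolding block_gain_def by measurable
  qed
  have sum_int: "integrable M ?sum"
    by (intro Bochner_Integration.integrable_sum integrable_real_mult_indicator blk_event block_gain_integrable)
  have probs: "(\<Sum>i=1..m. ?g i \<omega> * prob (?B i)) = (\<Sum>i=1..m. ?g i \<omega> * (1 / real m))" for \<omega>
    by (intro sum.cong refl) (simp only: prob_blk)
  have "AE \<omega> in M. real_cond_exp M ?G ?sum \<omega> = (\<Sum>i=1..m. ?g i \<omega> * (1 / real m))"
    unfolding probs[symmetric]
    by (rule real_cond_exp_independent_choice[OF subalgebra_G])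
       (auto simp only: finite_atLeastAtMost intro: blk_event blk_indep_G g_G block_gain_integrable)
  moreover have "AE \<omega> in M. real_cond_exp M ?G ?base \<omega> = ?base \<omega>"
    by (rule G.real_cond_exp_F_meas[OF base_int base_G])
  moreover have "AE \<omega> in M. real_cond_exp M ?G (\<lambda>\<omega>. ?base \<omega> + ?sum \<omega>) \<omega>
      = real_cond_exp M ?G ?base \<omega> + real_cond_exp M ?G ?sum \<omega>"
    by (rule G.real_cond_exp_add[OF base_int sum_int])
  moreover have "AE \<omega> in M. real_cond_exp M ?G (arock_xi r c q m xstar x (Suc k)) \<omega>
      = real_cond_exp M ?G (\<lambda>\<omega>. ?base \<omega> + ?sum \<omega>) \<omega>"
  proof (rule G.real_cond_exp_cong)
    show "AE \<omega> in M. arock_xi r c q m xstar x (Suc k) \<omega> = ?base \<omega> + ?sum \<omega>"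
      by (rule AE_I2) (rule arock_xi_Suc)
  qed (use arock_xi_integrable base_int sum_int in \<open>auto intro!: borel_measurable_add\<close>)
  ultimately show ?thesis
    by eventually_elim simp
qed

end

lemma lyapunov_descent:
  assumes r: "0 < r" "r < 1" and c: "0 < c" and \<gamma>: "0 < arock_gamma r c q m"
    and \<eta>: "\<forall>k. \<forall>\<omega>\<in>space M. 0 \<le> \<eta> k \<omega> \<and> \<eta> k \<omega> \<le> arock_H1 r c q m (current_delay m j k)"
  shows "integrable M (arock_xi r c q m xstar x k)"
    and "AE \<omega> in M. real_cond_exp M (filtration_G M x k) (arock_xi r c q m xstar x (Suc k)) \<omega>
      \<le> arock_R r m (\<eta> k \<omega>) (arock_H2 r c q m (current_delay m j k)) * arock_xi r c q m xstar x k \<omega>"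
proof -
  have \<eta>1: "\<forall>k. \<forall>\<omega>\<in>space M. 0 \<le> \<eta> k \<omega> \<and> \<eta> k \<omega> \<le> 1"
    using \<eta> arock_H1_le_1[OF r c m_pos \<gamma>] by (meson order_trans)
  show "integrable M (arock_xi r c q m xstar x k)"
    by (rule arock_xi_integrable[OF \<eta>1])
  show "AE \<omega> in M. real_cond_exp M (filtration_G M x k) (arock_xi r c q m xstar x (Suc k)) \<omega>
      \<le> arock_R r m (\<eta> k \<omega>) (arock_H2 r c q m (current_delay m j k)) * arock_xi r c q m xstar x k \<omega>"
    using cond_exp_arock_xi[OF \<eta>1, of k c q] AE_space
  proof eventually_elim
    case (elim \<omega>)
    then show ?case
      using averaged_lyapunov_descent[OF r c \<gamma>] \<eta> by simp
  qed
qed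

text \<open>
  Integrating the conditional descent and iterating it. Without past increments at time 0, the Lyapunov function starts at the squared distance.
\<close>

lemma expected_lyapunov_decay:
  assumes r: "0 < r" "r < 1" and c: "0 < c" and \<gamma>: "0 < arock_gamma r c q m"
    and \<eta>: "\<forall>k. \<forall>\<omega>\<in>space M. 0 \<le> \<eta> k \<omega> \<and> \<eta> k \<omega> \<le> arock_H1 r c q m (current_delay m j k)"
    and R: "\<And>k \<omega>. \<omega> \<in> space M \<Longrightarrow> arock_R r m (\<eta> k \<omega>) (arock_H2 r c q m (current_delay m j k)) \<le> R"
    and "0 \<le> R"
  shows "(\<integral>\<omega>. arock_xi r c q m xstar x k \<omega> \<partial>M) \<le> R ^ k * (\<integral>\<omega>. (norm (x 0 \<omega> - xstar))\<^sup>2 \<partial>M)"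
proof (induction k)
  case 0
  show ?case
    by (simp add: arock_xi_eq)
next
  case (Suc k)
  interpret G: finite_measure_subalgebra M "filtration_G M x k"
    by unfold_locales (rule subalgebra_G)
  note int = lyapunov_descent(1)[OF r c \<gamma> \<eta>]
  have nonneg: "0 \<le> arock_xi r c q m xstar x k \<omega>" for \<omega>
    unfolding arock_xi_eq using arock_coeff_nonneg[OF r c m_pos \<gamma>]
    by (intro add_nonneg_nonneg mult_nonneg_nonneg sum_nonneg) auto
  have "(\<integral>\<omega>. arock_xi r c q m xstar x (Suc k) \<omega> \<partial>M)
      = (\<integral>\<omega>. real_cond_exp M (filtration_G M x k) (arock_xi r c q m xstar x (Suc k)) \<omega> \<partial>M)"
    by (rule G.real_cond_exp_int(2)[OF int, symmetric])
  also have "\<dots> \<le> (\<integral>\<omega>. R * arock_xi r c q m xstar x k \<omega> \<partial>M)"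
  proof (rule integral_mono_AE[OF G.real_cond_exp_int(1)[OF int] integrable_mult_right[OF int]])
    show "AE \<omega> in M. real_cond_exp M (filtration_G M x k) (arock_xi r c q m xstar x (Suc k)) \<omega>
        \<le> R * arock_xi r c q m xstar x k \<omega>"
      using lyapunov_descent(2)[OF r c \<gamma> \<eta>, of k] AE_space
    proof eventually_elim
      case (elim \<omega>)
      then show ?case
        using mult_right_mono[OF R[OF elim(2), of k] nonneg] by (meson order_trans)
    qed
  qed
  also have "\<dots> = R * (\<integral>\<omega>. arock_xi r c q m xstar x k \<omega> \<partial>M)"
    by simp
  also have "\<dots> \<le> R * (R ^ k * (\<integral>\<omega>. (norm (x 0 \<omega> - xstar))\<^sup>2 \<partial>M))"
    by (rule mult_left_mono[OF Suc.IH \<open>0 \<le> R\<close>])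
  finally show ?case
    by (simp add: mult.assoc)
qed

lemma expected_distance_le_lyapunov:
  assumes r: "0 < r" "r < 1" and c: "0 < c" and \<gamma>: "0 < arock_gamma r c q m"
    and \<eta>: "\<forall>k. \<forall>\<omega>\<in>space M. 0 \<le> \<eta> k \<omega> \<and> \<eta> k \<omega> \<le> arock_H1 r c q m (current_delay m j k)"
  shows "(\<integral>\<omega>. (norm (x k \<omega> - xstar))\<^sup>2 \<partial>M) \<le> (\<integral>\<omega>. arock_xi r c q m xstar x k \<omega> \<partial>M)"
proof (rule integral_mono)
  have \<eta>1: "\<forall>k. \<forall>\<omega>\<in>space M. 0 \<le> \<eta> k \<omega> \<and> \<eta> k \<omega> \<le> 1"
    using \<eta> arock_H1_le_1[OF r c m_pos \<gamma>] by (meson order_trans)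
  show "integrable M (\<lambda>\<omega>. (norm (x k \<omega> - xstar))\<^sup>2)"
    by (rule square_integrable_norm2[OF iterate_square_integrable[OF \<eta>1]])
  show "integrable M (arock_xi r c q m xstar x k)"
    by (rule lyapunov_descent(1)[OF r c \<gamma> \<eta>])
  show "(norm (x k \<omega> - xstar))\<^sup>2 \<le> arock_xi r c q m xstar x k \<omega>" for \<omega>
    unfolding arock_xi_eq using arock_coeff_nonneg[OF r c m_pos \<gamma>]
    by (simp add: sum_nonneg)
qed

end

section \<open>Asymptotics of the rate\<close>

text \<open>
  With \<open>a = c\<^sup>-\<^sup>1 m\<^bsup>q-1/2\<^esup> (3 + \<gamma>\<^bsup>-n\<^esup>)\<close> one has \<open>H\<^sub>1 = 1/(1 + a) \<ge> 1 - a\<close>, while \<open>H\<^sub>1\<^sup>2/H\<^sub>2 \<le> 1/H\<^sub>2\<close> costs another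
  half of the term with \<open>\<gamma>\<^bsup>-n\<^esup>\<close>; hence the factor \<open>3/2\<close>.
\<close>

lemma arock_rate_le:
  assumes r: "0 < r" "r < 1" and c: "0 < c" and m: "1 \<le> m" and \<gamma>: "0 < arock_gamma r c q m"
    and g: "arock_gamma r c q m powi (- int n) \<le> g"
  shows "arock_R r m (arock_H1 r c q m n) (arock_H2 r c q m n)
    \<le> 1 - 1 / real m * (1 - r\<^sup>2) * (1 - 1 / c * real m powr (q - 1/2) * (3 + 3/2 * g))"
proof -
  note hyps = r c m \<gamma>
  let ?H1 = "arock_H1 r c q m n" and ?H2 = "arock_H2 r c q m n"
  define u where "u = 1 / c * real m powr (q - 1/2)"
  define a where "a = u * 3 + 2 / ?H2"
  have u: "0 \<le> u"
    using c by (simp add: u_def)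
  have H2: "2 / ?H2 \<le> u * g" "0 < ?H2"
    unfolding two_over_arock_H2[OF hyps] inverse_eq_divide u_def[symmetric]
    using g u arock_H2_pos[OF hyps] by (auto intro: mult_left_mono)
  have a: "0 \<le> a"
    using u H2(2) by (simp add: a_def)
  have H1: "?H1 = inverse (1 + a)"
    unfolding a_def arock_H1_eq[OF hyps] u_def by (simp add: inverse_eq_divide add.assoc)
  have "1 - a \<le> ?H1"
    using a by (simp add: H1 field_simps)
  moreover have "?H1 * (?H1 / ?H2) \<le> 1 * (1 / ?H2)"
    using H2(2) arock_H1_pos[OF hyps] arock_H1_le_1[OF hyps]
    by (intro mult_mono divide_right_mono) (auto simp: less_imp_le)
  ultimately have "1 - u * (3 + 3/2 * g) \<le> ?H1 * (1 - ?H1 / ?H2)"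
    using H2(1) by (simp add: a_def algebra_simps)
  then have "1 / real m * (1 - r\<^sup>2) * (1 - u * (3 + 3/2 * g)) \<le> 1 / real m * (1 - r\<^sup>2) * (?H1 * (1 - ?H1 / ?H2))"
    using r by (intro mult_left_mono) (auto simp: power_le_one_iff)
  moreover have "arock_R r m ?H1 ?H2 = 1 - 1 / real m * (1 - r\<^sup>2) * (?H1 * (1 - ?H1 / ?H2))"
    by (simp add: arock_R_def)
  ultimately show ?thesis
    unfolding u_def[symmetric] by linarith
qed

lemma gamma_tendsto:
  assumes "0 \<le> q"
  shows "arock_gamma r c q \<longlonglongrightarrow> (if q = 0 then 1 - c else 1)"
proof (cases "q = 0")
  case True
  have "(\<lambda>m. 1 - 1 / real m * (1 - r\<^sup>2) - c) \<longlonglongrightarrow> 1 - c"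
    by real_asymp
  moreover have "\<forall>\<^sub>F m in sequentially. 1 - 1 / real m * (1 - r\<^sup>2) - c = arock_gamma r c q m"
    using eventually_gt_at_top[of 0] by eventually_elim (simp add: True arock_gamma_def arock_rho_def)
  ultimately show ?thesis
    using True by (auto intro: Lim_transform_eventually)
next
  case False
  then have "0 < q"
    using assms by simp
  then have "(\<lambda>m. 1 - 1 / real m * (1 - r\<^sup>2) - c * real m powr (- q)) \<longlonglongrightarrow> 1"
    by real_asymp
  then show ?thesis
    using False by (simp add: arock_gamma_def[abs_def] arock_rho_def)
qed

text \<open>
  For \<open>q > 0\<close>, \<open>ln \<gamma>\<close> is asymptotic to \<open>- c m\<^bsup>-q\<^esup>\<close>, so the largest admissible exponent \<open>b m\<^sup>q + d\<close> yields
  the limit \<open>exp (b c)\<close>. For \<open>q = 0\<close> the delays are bounded by the integer part of \<open>b + d\<close> and \<open>\<gamma>\<close> tends to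
  \<open>1 - c\<close>, so the limit is at most \<open>exp (b c)\<close> by hypothesis.
\<close>

lemma inverse_gamma_power_bound:
  assumes r: "0 < r" "r < 1" and c: "0 < c" and q: "0 \<le> q" "q < 1/2" and bd: "0 < b" "0 < d"
    and q0: "q = 0 \<longrightarrow> c < 1 \<and> (1 - c) powi (- \<lfloor>b + d\<rfloor>) \<le> exp (b * c)"
  obtains v where "v \<longlonglongrightarrow> 0"
    and "\<forall>\<^sub>F m in sequentially. 0 < arock_gamma r c q m \<and>
      (\<forall>n. real n \<le> b * real m powr q + d \<longrightarrow> arock_gamma r c q m powi (- int n) \<le> exp (b * c) + v m)"
proof -
  have pos: "\<forall>\<^sub>F m in sequentially. 0 < arock_gamma r c q m"
    using order_tendstoD(1)[OF gamma_tendsto[OF q(1), of r c], of 0] q0 by auto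
  have m1: "\<forall>\<^sub>F m::nat in sequentially. 1 \<le> m"
    by (rule eventually_ge_at_top)
  show thesis
  proof (cases "q = 0")
    case True
    define N where "N = nat \<lfloor>b + d\<rfloor>"
    have N: "\<lfloor>b + d\<rfloor> = int N"
      using bd by (simp add: N_def)
    define v where "v m = \<bar>arock_gamma r c q m powi (- int N) - (1 - c) powi (- int N)\<bar>" for m
    have "arock_gamma r c q \<longlonglongrightarrow> 1 - c"
      using gamma_tendsto[OF q(1), of r c] True by simp
    then have "(\<lambda>m. arock_gamma r c q m powi (- int N)) \<longlonglongrightarrow> (1 - c) powi (- int N)"
      by (rule tendsto_power_int) (use q0 True in auto)
    then have "v \<longlonglongrightarrow> 0"
      unfolding v_def by (intro tendsto_rabs_zero) (simp add: LIM_zero)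
    moreover have "\<forall>\<^sub>F m in sequentially. 0 < arock_gamma r c q m \<and>
      (\<forall>n. real n \<le> b * real m powr q + d \<longrightarrow> arock_gamma r c q m powi (- int n) \<le> exp (b * c) + v m)"
      using pos m1
    proof eventually_elim
      case (elim m)
      have "arock_gamma r c q m powi (- int n) \<le> exp (b * c) + v m" if "real n \<le> b * real m powr q + d" for n
      proof -
        have "n \<le> N"
          using that elim True unfolding N_def by (simp add: le_nat_floor)
        then have "arock_gamma r c q m ^ N \<le> arock_gamma r c q m ^ n"
          by (rule power_decreasing) (use elim arock_gamma_le_1[OF r c elim(2,1)] in auto)
        then have "arock_gamma r c q m powi (- int n) \<le> arock_gamma r c q m powi (- int N)"
          using elim by (simp add: power_int_minus le_imp_inverse_le)
        also have "\<dots> \<le> (1 - c) powi (- int N) + v m"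
          unfolding v_def by linarith
        also have "\<dots> \<le> exp (b * c) + v m"
          using q0 True by (simp add: N)
        finally show ?thesis .
      qed
      then show ?case
        using elim by blast
    qed
    ultimately show thesis
      by (rule that)
  next
    case False
    then have q_pos: "0 < q"
      using q by simp
    define E where "E m = exp (- (b * real m powr q + d) * ln (arock_gamma r c q m))" for m
    define v where "v m = \<bar>E m - exp (b * c)\<bar>" for m
    have "(\<lambda>m. - (b * real m powr q + d) * ln (arock_gamma r c q m)) \<longlonglongrightarrow> b * c"
      unfolding arock_gamma_def arock_rho_def using q_pos q c bd by real_asymp
    then have "E \<longlonglongrightarrow> exp (b * c)"
      unfolding E_def by (rule tendsto_exp)
    then have "v \<longlonglongrightarrow> 0"
      unfolding v_def by (intro tendsto_rabs_zero) (simp add: LIM_zero)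
    moreover have "\<forall>\<^sub>F m in sequentially. 0 < arock_gamma r c q m \<and>
      (\<forall>n. real n \<le> b * real m powr q + d \<longrightarrow> arock_gamma r c q m powi (- int n) \<le> exp (b * c) + v m)"
      using pos m1
    proof eventually_elim
      case (elim m)
      have "arock_gamma r c q m powi (- int n) \<le> exp (b * c) + v m" if "real n \<le> b * real m powr q + d" for n
      proof -
        have ln: "ln (arock_gamma r c q m) \<le> 0"
          using elim arock_gamma_le_1[OF r c elim(2,1)] by simp
        have "arock_gamma r c q m powi (- int n) = exp (- real n * ln (arock_gamma r c q m))"
          using elim by (simp add: power_int_minus exp_minus exp_of_nat_mult)
        also have "\<dots> \<le> E m"
          using mult_right_mono_neg[OF that ln] by (simp add: E_def algebra_simps)
        also have "\<dots> \<le> exp (b * c) + v m"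
          unfolding v_def by linarith
        finally show ?thesis .
      qed
      then show ?case
        using elim by blast
    qed
    ultimately show thesis
      by (rule that)
  qed
qed

section \<open>Epoch complexity\<close>

lemma epoch_complexity_mono:
  assumes ex: "\<exists>K. \<forall>k\<ge>K. g k \<le> \<epsilon> * g 0" and imp: "\<And>k. g k \<le> \<epsilon> * g 0 \<Longrightarrow> f k \<le> \<epsilon> * f 0"
  shows "epoch_complexity m f \<epsilon> \<le> epoch_complexity m g \<epsilon>"
proof -
  have "\<forall>k\<ge>(LEAST K. \<forall>k\<ge>K. g k \<le> \<epsilon> * g 0). g k \<le> \<epsilon> * g 0"
    using ex by (rule LeastI_ex)
  then have "(LEAST K. \<forall>k\<ge>K. f k \<le> \<epsilon> * f 0) \<le> (LEAST K. \<forall>k\<ge>K. g k \<le> \<epsilon> * g 0)"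
    using imp by (intro Least_le) blast
  then show ?thesis
    unfolding epoch_complexity_def by (intro divide_right_mono) auto
qed

lemma geometric_eventually_small:
  fixes R \<epsilon> :: real
  assumes "0 \<le> R" "R < 1" "0 < \<epsilon>"
  shows "\<exists>K. \<forall>k\<ge>K. R ^ k \<le> \<epsilon> * R ^ 0"
proof -
  have "(\<lambda>k. R ^ k) \<longlonglongrightarrow> 0"
    using assms by (intro LIMSEQ_power_zero) simp
  from order_tendstoD(2)[OF this \<open>0 < \<epsilon>\<close>] show ?thesis
    unfolding eventually_sequentially by (auto intro: less_imp_le)
qed

text \<open>
  From \<open>z \<le> - ln (1 - z) \<le> z / (1 - z)\<close>; the additional 1 in the upper bound is the rounding to an
  integer.
\<close>

lemma geometric_hitting_time_bounds:
  fixes z \<epsilon> :: real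
  assumes z: "0 < z" "z < 1" and \<epsilon>: "0 < \<epsilon>" "\<epsilon> < 1"
  defines "K \<equiv> LEAST K. \<forall>k\<ge>K. (1 - z) ^ k \<le> \<epsilon> * (1 - z) ^ 0"
  shows "ln (1 / \<epsilon>) * (1 / z - 1) \<le> real K" "real K \<le> ln (1 / \<epsilon>) / z + 1"
proof -
  have L: "0 < ln (1 / \<epsilon>)"
    using \<epsilon> by simp
  have iff: "(1 - z) ^ k \<le> \<epsilon> \<longleftrightarrow> ln (1 / \<epsilon>) \<le> real k * - ln (1 - z)" for k
  proof -
    have "(1 - z) ^ k \<le> \<epsilon> \<longleftrightarrow> ln ((1 - z) ^ k) \<le> ln \<epsilon>"
      using z \<epsilon> by (intro ln_le_cancel_iff[symmetric]) auto
    then show ?thesis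
      using z \<epsilon> by (simp add: ln_realpow ln_div)
  qed
  have ln_ge: "z \<le> - ln (1 - z)"
    using ln_le_minus_one[of "1 - z"] z by simp
  have ln_le: "- ln (1 - z) * (1 - z) \<le> z"
  proof -
    have "- ln (1 - z) = ln (1 / (1 - z))"
      using z by (simp add: ln_div)
    also have "\<dots> \<le> 1 / (1 - z) - 1"
      using z by (intro ln_le_minus_one) simp
    finally show ?thesis
      using z by (simp add: field_simps)
  qed
  have K: "\<forall>k\<ge>K. (1 - z) ^ k \<le> \<epsilon> * (1 - z) ^ 0"
    unfolding K_def by (rule LeastI_ex) (rule geometric_eventually_small, use z \<epsilon> in auto)
  then have "(1 - z) ^ K \<le> \<epsilon> * (1 - z) ^ 0"
    by blast
  then have "ln (1 / \<epsilon>) \<le> real K * - ln (1 - z)"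
    unfolding power_0 mult_1_right iff .
  then have "ln (1 / \<epsilon>) * (1 - z) \<le> real K * - ln (1 - z) * (1 - z)"
    using z by (intro mult_right_mono) auto
  also have "\<dots> \<le> real K * z"
    unfolding mult.assoc using ln_le by (intro mult_left_mono) auto
  finally have "ln (1 / \<epsilon>) * (1 - z) / z \<le> real K"
    unfolding pos_divide_le_eq[OF z(1)] .
  moreover have "L * (1 - z) / z = L * (1 / z - 1)" for L
    using z by (simp add: field_simps)
  ultimately show "ln (1 / \<epsilon>) * (1 / z - 1) \<le> real K"
    by simp
  have least: "K \<le> n" if "\<forall>k\<ge>n. (1 - z) ^ k \<le> \<epsilon> * (1 - z) ^ 0" for n
    unfolding K_def using that by (rule Least_le)
  show "real K \<le> ln (1 / \<epsilon>) / z + 1"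
  proof (rule ccontr)
    assume "\<not> ?thesis"
    moreover have "0 < ln (1 / \<epsilon>) / z"
      using L z by simp
    ultimately have "1 < real K"
      by linarith
    then have K1: "1 \<le> K"
      by simp
    with \<open>\<not> ?thesis\<close> have gt: "ln (1 / \<epsilon>) / z < real (K - 1)"
      by (simp add: of_nat_diff)
    have "ln (1 / \<epsilon>) \<le> real k * - ln (1 - z)" if "k \<ge> K - 1" for k
    proof -
      have "ln (1 / \<epsilon>) \<le> real (K - 1) * z"
        using gt unfolding pos_divide_less_eq[OF z(1)] by simp
      also have "\<dots> \<le> real k * - ln (1 - z)"
        using that ln_ge z by (intro mult_mono) auto
      finally show ?thesis .
    qed
    then have "\<forall>k\<ge>K - 1. (1 - z) ^ k \<le> \<epsilon> * (1 - z) ^ 0"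
      unfolding power_0 mult_1_right iff by blast
    then have "K \<le> K - 1"
      by (rule least)
    then show False
      using K1 by simp
  qed
qed

text \<open>
  With \<open>z = (s/m) (1 - A)\<close> the bounds on the hitting time give the number of epochs as
  \<open>ln (1/\<epsilon>) / (m z) = ln (1/\<epsilon>) / (s (1 - A))\<close> up to \<open>O(1/m)\<close>, and \<open>1/(1 - A) = 1 + A + O(A\<^sup>2)\<close>.
\<close>

lemma epoch_complexity_expansion:
  fixes A :: "nat \<Rightarrow> real"
  assumes s: "0 < s" and q: "0 \<le> q" "q < 1/2" and \<epsilon>: "0 < \<epsilon>" "\<epsilon> < 1"
    and A: "A \<in> O(\<lambda>m. real m powr (q - 1/2))"
  shows "(\<lambda>m. epoch_complexity m (\<lambda>k. (1 - 1 / real m * s * (1 - A m)) ^ k) \<epsilon> * s / ln (1 / \<epsilon>) - 1 - A m)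
    \<in> o(\<lambda>m. real m powr (q - 1/2))"
    and "\<forall>\<^sub>F m in sequentially. 0 < 1 - 1 / real m * s * (1 - A m) \<and> 1 - 1 / real m * s * (1 - A m) < 1"
proof -
  let ?p = "\<lambda>m. real m powr (q - 1/2)"
  let ?L = "ln (1 / \<epsilon>)"
  have L: "0 < ?L"
    using \<epsilon> by simp
  have "?p \<in> o(\<lambda>m::nat. 1::real)"
    using q by real_asymp
  with A have A1: "A \<in> o(\<lambda>m. 1)"
    by (rule landau_o.big_small_trans)
  then have "A \<longlonglongrightarrow> 0"
    using smalloD_tendsto[OF A1] by simp
  then have "\<forall>\<^sub>F m in sequentially. \<bar>A m\<bar> < 1/2"
    by (intro order_tendstoD(2)[OF tendsto_rabs_zero]) auto
  moreover have "\<forall>\<^sub>F m in sequentially. 2 * s + 1 < real m"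
    by real_asymp
  ultimately have small: "\<forall>\<^sub>F m in sequentially. \<bar>A m\<bar> < 1/2 \<and> 2 * s + 1 < real m"
    by eventually_elim simp
  have z: "0 < 1 / real m * s * (1 - A m)" "1 / real m * s * (1 - A m) < 1"
    if "\<bar>A m\<bar> < 1/2 \<and> 2 * s + 1 < real m" for m
  proof -
    have "0 < 1 - A m" "1 - A m \<le> 2" "0 < real m"
      using that s by auto
    then have "s * (1 - A m) \<le> s * 2" and pos: "0 < s * (1 - A m)" and m: "0 < real m"
      using s by (auto intro: mult_left_mono)
    then have "s * (1 - A m) < 1 * real m"
      using that by linarith
    then have "s * (1 - A m) / real m < 1"
      unfolding pos_divide_less_eq[OF m] .
    moreover have "0 < s * (1 - A m) / real m"
      using pos m by (rule divide_pos_pos)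
    ultimately show "0 < 1 / real m * s * (1 - A m)" "1 / real m * s * (1 - A m) < 1"
      by simp_all
  qed
  show "\<forall>\<^sub>F m in sequentially. 0 < 1 - 1 / real m * s * (1 - A m) \<and> 1 - 1 / real m * s * (1 - A m) < 1"
    using small
  proof eventually_elim
    case (elim m)
    then show ?case
      using z[OF elim] by simp
  qed
  have "\<forall>\<^sub>F m in sequentially. norm (epoch_complexity m (\<lambda>k. (1 - 1 / real m * s * (1 - A m)) ^ k) \<epsilon> * s / ?L - 1 - A m)
      \<le> norm (2 * (A m * A m) + (s + s / ?L) * (1 / real m))"
    using small
  proof eventually_elim
    case (elim m)
    define z where "z = 1 / real m * s * (1 - A m)"
    define K where "K = real (LEAST K. \<forall>k\<ge>K. (1 - z) ^ k \<le> \<epsilon> * (1 - z) ^ 0)"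
    have m: "0 < real m"
      using elim s by linarith
    have "0 < z" "z < 1"
      using z[OF elim] by (simp_all add: z_def)
    from geometric_hitting_time_bounds[OF this \<epsilon>]
    have K: "?L * (1 / z - 1) \<le> K" "K \<le> ?L / z + 1"
      by (simp_all add: K_def)
    have inv: "s / (real m * z) = 1 / (1 - A m)"
      using m s by (simp add: z_def)
    have epoch: "epoch_complexity m (\<lambda>k. (1 - 1 / real m * s * (1 - A m)) ^ k) \<epsilon> * s / ?L = K * (s / (real m * ?L))"
      unfolding z_def[symmetric] by (simp add: epoch_complexity_def K_def)
    have arith: "(L / z + 1) * (s / (M * L)) = s / (M * z) + s / L * (1 / M)"
        "s / (M * z) - s * (1 / M) = (L * (1 / z - 1)) * (s / (M * L))"
      if "L \<noteq> 0" "M \<noteq> 0" "z \<noteq> 0" for L M z :: real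
      using that by (simp_all add: field_simps)
    have nz: "?L \<noteq> 0" "real m \<noteq> 0" "z \<noteq> 0"
      using L m \<open>0 < z\<close> by auto
    have coef: "0 \<le> s / (real m * ?L)"
      using s m L by simp
    have "K * (s / (real m * ?L)) \<le> (?L / z + 1) * (s / (real m * ?L))"
      by (rule mult_right_mono[OF K(2) coef])
    also have "\<dots> = s / (real m * z) + s / ?L * (1 / real m)"
      by (rule arith(1)[OF nz])
    finally have upper: "K * (s / (real m * ?L)) \<le> 1 / (1 - A m) + s / ?L * (1 / real m)"
      unfolding inv .
    have "s / (real m * z) - s * (1 / real m) = (?L * (1 / z - 1)) * (s / (real m * ?L))"
      by (rule arith(2)[OF nz])
    also have "\<dots> \<le> K * (s / (real m * ?L))"
      by (rule mult_right_mono[OF K(1) coef])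
    finally have lower: "1 / (1 - A m) - s * (1 / real m) \<le> K * (s / (real m * ?L))"
      unfolding inv .
    have A_lt: "1/2 < 1 - A m"
      using elim by linarith
    then have "1 / (1 - A m) - 1 - A m = A m * A m / (1 - A m)"
      by (simp add: field_simps)
    moreover have "A m * A m / (1 - A m) \<le> A m * A m / (1/2)"
      using A_lt by (intro divide_left_mono) auto
    moreover have "0 \<le> A m * A m / (1 - A m)"
      using A_lt by (intro divide_nonneg_pos) auto
    ultimately have expansion: "0 \<le> 1 / (1 - A m) - 1 - A m" "1 / (1 - A m) - 1 - A m \<le> 2 * (A m * A m)"
      by simp_all
    have nonneg: "0 \<le> s * (1 / real m)" "0 \<le> s / ?L * (1 / real m)" "0 \<le> A m * A m"
      using s m L by auto
    show ?case
      unfolding epoch distrib_right[of s] real_norm_def using upper lower expansion nonneg by linarith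
  qed
  then have "(\<lambda>m. epoch_complexity m (\<lambda>k. (1 - 1 / real m * s * (1 - A m)) ^ k) \<epsilon> * s / ?L - 1 - A m)
      \<in> O(\<lambda>m. 2 * (A m * A m) + (s + s / ?L) * (1 / real m))"
    by (rule landau_o.big_mono)
  also have "(\<lambda>m. 2 * (A m * A m) + (s + s / ?L) * (1 / real m)) \<in> o(?p)"
  proof (rule sum_in_smallo)
    have "(\<lambda>m. A m * A m) \<in> o(\<lambda>m. 1 * ?p m)"
      by (rule landau_o.small_big_mult[OF A1 A])
    then show "(\<lambda>m. 2 * (A m * A m)) \<in> o(?p)"
      by simp
    have "(\<lambda>m. 1 / real m) \<in> o(?p)"
      using q by real_asymp
    then have "(\<lambda>m. K * (1 / real m)) \<in> o(?p)" for K
      by (cases "K = 0") (simp_all only: landau_o.small.cmult_in_iff mult_zero_left zero_in_smallo not_False_eq_True)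
    then show "(\<lambda>m. (s + s / ?L) * (1 / real m)) \<in> o(?p)" .
  qed
  finally show "(\<lambda>m. epoch_complexity m (\<lambda>k. (1 - 1 / real m * s * (1 - A m)) ^ k) \<epsilon> * s / ?L - 1 - A m) \<in> o(?p)" .
qed

context arock
begin

text \<open>
  Both errors are dominated by \<open>R\<^sup>k D\<close>, where \<open>D\<close> is their common initial value.
\<close>

lemma epoch_complexity_le_geometric:
  assumes r: "0 < r" "r < 1" and c: "0 < c" and \<gamma>: "0 < arock_gamma r c q m"
    and \<eta>: "\<forall>k. \<forall>\<omega>\<in>space M. 0 \<le> \<eta> k \<omega> \<and> \<eta> k \<omega> \<le> arock_H1 r c q m (current_delay m j k)"
    and R: "\<And>k \<omega>. \<omega> \<in> space M \<Longrightarrow> arock_R r m (\<eta> k \<omega>) (arock_H2 r c q m (current_delay m j k)) \<le> R"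
    and R01: "0 \<le> R" "R < 1" and \<epsilon>: "0 < \<epsilon>"
  shows "epoch_complexity m (\<lambda>k. \<integral>\<omega>. arock_xi r c q m xstar x k \<omega> \<partial>M) \<epsilon> \<le> epoch_complexity m (\<lambda>k. R ^ k) \<epsilon>"
    and "epoch_complexity m (\<lambda>k. \<integral>\<omega>. (norm (x k \<omega> - xstar))\<^sup>2 \<partial>M) \<epsilon> \<le> epoch_complexity m (\<lambda>k. R ^ k) \<epsilon>"
proof -
  note hyps = r c \<gamma>
  define D where "D = (\<integral>\<omega>. (norm (x 0 \<omega> - xstar))\<^sup>2 \<partial>M)"
  have D: "0 \<le> D"
    unfolding D_def by (rule Bochner_Integration.integral_nonneg) simp
  have decay: "(\<integral>\<omega>. arock_xi r c q m xstar x k \<omega> \<partial>M) \<le> R ^ k * D" for k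
    unfolding D_def by (rule expected_lyapunov_decay[OF hyps \<eta> R R01(1)])
  have start: "(\<integral>\<omega>. arock_xi r c q m xstar x 0 \<omega> \<partial>M) = D"
    by (simp add: arock_xi_eq D_def)
  have small: "R ^ k * D \<le> \<epsilon> * D" if "R ^ k \<le> \<epsilon> * R ^ 0" for k
    using that D by (intro mult_right_mono) auto
  note ex = geometric_eventually_small[OF R01 \<epsilon>]
  show "epoch_complexity m (\<lambda>k. \<integral>\<omega>. arock_xi r c q m xstar x k \<omega> \<partial>M) \<epsilon> \<le> epoch_complexity m (\<lambda>k. R ^ k) \<epsilon>"
  proof (rule epoch_complexity_mono[OF ex])
    fix k assume k: "R ^ k \<le> \<epsilon> * R ^ 0"
    show "(\<integral>\<omega>. arock_xi r c q m xstar x k \<omega> \<partial>M) \<le> \<epsilon> * (\<integral>\<omega>. arock_xi r c q m xstar x 0 \<omega> \<partial>M)"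
      unfolding start using decay small[OF k] by (rule order_trans)
  qed
  show "epoch_complexity m (\<lambda>k. \<integral>\<omega>. (norm (x k \<omega> - xstar))\<^sup>2 \<partial>M) \<epsilon> \<le> epoch_complexity m (\<lambda>k. R ^ k) \<epsilon>"
  proof (rule epoch_complexity_mono[OF ex])
    fix k assume k: "R ^ k \<le> \<epsilon> * R ^ 0"
    show "(\<integral>\<omega>. (norm (x k \<omega> - xstar))\<^sup>2 \<partial>M) \<le> \<epsilon> * (\<integral>\<omega>. (norm (x 0 \<omega> - xstar))\<^sup>2 \<partial>M)"
      unfolding D_def[symmetric]
      using expected_distance_le_lyapunov[OF hyps \<eta>, of k] decay[of k] small[OF k] by linarith
  qed
qed

end

theorem theorem3:
  fixes r c q :: real
  assumes "0 < r" and "r < 1" and "0 < c" and "0 \<le> q" and "q < 1/2"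
  shows
    "(\<forall>(M :: 'w measure) m V (T :: 'h::{real_inner, banach, second_countable_topology} \<Rightarrow> 'h) xstar x blk \<eta> j.
        arock M m V T r xstar x blk \<eta> j \<longrightarrow>
        0 < arock_gamma r c q m \<longrightarrow>
        (\<forall>k. \<forall>\<omega>\<in>space M. 0 \<le> \<eta> k \<omega> \<and> \<eta> k \<omega> \<le> arock_H1 r c q m (current_delay m j k)) \<longrightarrow>
        (\<forall>k. integrable M (arock_xi r c q m xstar x (Suc k)) \<and>
             (AE \<omega> in M.
                real_cond_exp M (filtration_G M x k) (arock_xi r c q m xstar x (Suc k)) \<omega>
                  \<le> arock_R r m (\<eta> k \<omega>) (arock_H2 r c q m (current_delay m j k))
                      * arock_xi r c q m xstar x k \<omega>)))
     \<and>
     (\<forall>b d :: real. 0 < b \<longrightarrow> 0 < d \<longrightarrow>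
        (q = 0 \<longrightarrow> c < 1 \<and> (1 - c) powi (- \<lfloor>b + d\<rfloor>) \<le> exp (b * c)) \<longrightarrow>
        (\<exists>e \<in> o(\<lambda>m. real m powr (q - 1/2)).
           let Rbound = (\<lambda>m. 1 - 1 / real m * (1 - r\<^sup>2) *
                  (1 - 1 / c * real m powr (q - 1/2) * (3 + 3/2 * exp (b * c)) + e m))
           in
           (\<forall>\<^sub>F m in sequentially. \<forall>j :: nat \<Rightarrow> nat \<Rightarrow> nat.
              (\<forall>k. real (current_delay m j k) \<le> b * real m powr q + d) \<longrightarrow>
              (\<forall>k. arock_R r m (arock_H1 r c q m (current_delay m j k))
                               (arock_H2 r c q m (current_delay m j k)) \<le> Rbound m))
           \<and>
           (\<forall>\<epsilon>. 0 < \<epsilon> \<longrightarrow> \<epsilon> < 1 \<longrightarrow>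
              (\<exists>e' \<in> o(\<lambda>m. real m powr (q - 1/2)).
                 let I = (\<lambda>m. (1 + 1 / c * real m powr (q - 1/2) * (3 + 3/2 * exp (b * c)) + e' m)
                                * (1 / (1 - r\<^sup>2)) * ln (1 / \<epsilon>))
                 in
                 \<forall>\<^sub>F m in sequentially.
                   epoch_complexity m (\<lambda>k. Rbound m ^ k) \<epsilon> = I m \<and>
                   (\<forall>(M :: 'w measure) V (T :: 'h \<Rightarrow> 'h) xstar x blk \<eta> j.
                      arock M m V T r xstar x blk \<eta> j \<longrightarrow>
                      (\<forall>k. real (current_delay m j k) \<le> b * real m powr q + d) \<longrightarrow>
                      (\<forall>k. \<forall>\<omega>\<in>space M. \<eta> k \<omega> = arock_H1 r c q m (current_delay m j k)) \<longrightarrow>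
                      epoch_complexity m (\<lambda>k. \<integral>\<omega>. arock_xi r c q m xstar x k \<omega> \<partial>M) \<epsilon> \<le> I m \<and>
                      epoch_complexity m (\<lambda>k. \<integral>\<omega>. (norm (x k \<omega> - xstar))\<^sup>2 \<partial>M) \<epsilon> \<le> I m)))))"
proof (intro conjI allI impI)
  fix M :: "'w measure" and m V and T :: "'h \<Rightarrow> 'h" and xstar x blk \<eta> j k
  assume "arock M m V T r xstar x blk \<eta> j" and \<gamma>: "0 < arock_gamma r c q m"
    and \<eta>: "\<forall>k. \<forall>\<omega>\<in>space M. 0 \<le> \<eta> k \<omega> \<and> \<eta> k \<omega> \<le> arock_H1 r c q m (current_delay m j k)"
  then interpret arock M m V T r xstar x blk \<eta> j
    by simp
  show "integrable M (arock_xi r c q m xstar x (Suc k))"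
    by (rule lyapunov_descent(1)[OF assms(1-3) \<gamma> \<eta>])
  show "AE \<omega> in M. real_cond_exp M (filtration_G M x k) (arock_xi r c q m xstar x (Suc k)) \<omega>
      \<le> arock_R r m (\<eta> k \<omega>) (arock_H2 r c q m (current_delay m j k)) * arock_xi r c q m xstar x k \<omega>"
    by (rule lyapunov_descent(2)[OF assms(1-3) \<gamma> \<eta>])
next
  fix b d :: real
  assume bd: "0 < b" "0 < d" and q0: "q = 0 \<longrightarrow> c < 1 \<and> (1 - c) powi (- \<lfloor>b + d\<rfloor>) \<le> exp (b * c)"
  define s where "s = 1 - r\<^sup>2"
  have s: "0 < s"
    using assms by (simp add: s_def power_less_one_iff)
  define p where "p m = real m powr (q - 1/2)" for m :: nat
  define C where "C m = 1 / c * real m powr (q - 1/2) * (3 + 3/2 * exp (b * c))" for m :: nat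
  obtain v where v: "v \<longlonglongrightarrow> 0"
    and v_bound: "\<forall>\<^sub>F m in sequentially. 0 < arock_gamma r c q m \<and>
      (\<forall>n. real n \<le> b * real m powr q + d \<longrightarrow> arock_gamma r c q m powi (- int n) \<le> exp (b * c) + v m)"
    using inverse_gamma_power_bound[OF assms bd q0] by blast
  \<comment> \<open>The excess of the rate over its limit form is what replacing \<open>exp (b c)\<close> by
    \<open>exp (b c) + v m\<close> costs in \<open>arock_rate_le\<close>.\<close>
  define e where "e m = - (1 / c * real m powr (q - 1/2) * (3/2 * v m))" for m :: nat
  define R where "R m = 1 - 1 / real m * s * (1 - C m + e m)" for m
  have e: "e \<in> o(p)"
  proof -
    have "v \<in> o(\<lambda>_. 1)"
      by (rule smalloI_tendsto) (use v in auto)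
    then have "(\<lambda>m. p m * v m) \<in> o(\<lambda>m. p m * 1)"
      by (intro landau_o.big_small_mult) auto
    then have "(\<lambda>m. (- 3 / (2 * c)) * (p m * v m)) \<in> o(p)"
      using assms by simp
    also have "(\<lambda>m. (- 3 / (2 * c)) * (p m * v m)) = e"
      by (simp add: e_def p_def fun_eq_iff)
    finally show ?thesis .
  qed
  have C: "C \<in> O(p)"
  proof -
    have "(\<lambda>m. K * p m) \<in> O(p)" for K
      by (rule bigoI[of _ "\<bar>K\<bar>"]) (simp add: abs_mult)
    then have "(\<lambda>m. (1 / c * (3 + 3/2 * exp (b * c))) * p m) \<in> O(p)" .
    also have "(\<lambda>m. (1 / c * (3 + 3/2 * exp (b * c))) * p m) = C"
      by (simp add: C_def p_def fun_eq_iff)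
    finally show ?thesis .
  qed
  have A: "(\<lambda>m. C m - e m) \<in> O(\<lambda>m. real m powr (q - 1/2))"
    using C landau_o.small_imp_big[OF e] unfolding p_def by (rule sum_in_bigo)
  have R_A: "R m = 1 - 1 / real m * s * (1 - (C m - e m))" for m
    by (simp add: R_def)
  have rate: "\<forall>\<^sub>F m in sequentially. 1 \<le> m \<and> 0 < arock_gamma r c q m \<and> (\<forall>n. real n \<le> b * real m powr q + d \<longrightarrow>
      arock_R r m (arock_H1 r c q m n) (arock_H2 r c q m n) \<le> R m)"
    using v_bound eventually_ge_at_top[of 1]
  proof eventually_elim
    case (elim m)
    have "arock_R r m (arock_H1 r c q m n) (arock_H2 r c q m n) \<le> R m"
      if "real n \<le> b * real m powr q + d" for n
    proof -
      have "arock_R r m (arock_H1 r c q m n) (arock_H2 r c q m n)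
          \<le> 1 - 1 / real m * (1 - r\<^sup>2) * (1 - 1 / c * real m powr (q - 1/2) * (3 + 3/2 * (exp (b * c) + v m)))"
        using elim that by (intro arock_rate_le assms) auto
      also have "1 - 1 / c * real m powr (q - 1/2) * (3 + 3/2 * (exp (b * c) + v m)) = 1 - C m + e m"
        by (simp add: C_def e_def algebra_simps)
      finally show ?thesis
        by (simp add: R_def s_def)
    qed
    then show ?case
      using elim by blast
  qed
  show "\<exists>e \<in> o(\<lambda>m. real m powr (q - 1/2)).
           let Rbound = (\<lambda>m. 1 - 1 / real m * (1 - r\<^sup>2) *
                  (1 - 1 / c * real m powr (q - 1/2) * (3 + 3/2 * exp (b * c)) + e m))
           in
           (\<forall>\<^sub>F m in sequentially. \<forall>j :: nat \<Rightarrow> nat \<Rightarrow> nat.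
              (\<forall>k. real (current_delay m j k) \<le> b * real m powr q + d) \<longrightarrow>
              (\<forall>k. arock_R r m (arock_H1 r c q m (current_delay m j k))
                               (arock_H2 r c q m (current_delay m j k)) \<le> Rbound m))
           \<and>
           (\<forall>\<epsilon>. 0 < \<epsilon> \<longrightarrow> \<epsilon> < 1 \<longrightarrow>
              (\<exists>e' \<in> o(\<lambda>m. real m powr (q - 1/2)).
                 let I = (\<lambda>m. (1 + 1 / c * real m powr (q - 1/2) * (3 + 3/2 * exp (b * c)) + e' m)
                                * (1 / (1 - r\<^sup>2)) * ln (1 / \<epsilon>))
                 in
                 \<forall>\<^sub>F m in sequentially.
                   epoch_complexity m (\<lambda>k. Rbound m ^ k) \<epsilon> = I m \<and>
                   (\<forall>(M :: 'w measure) V (T :: 'h \<Rightarrow> 'h) xstar x blk \<eta> j.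
                      arock M m V T r xstar x blk \<eta> j \<longrightarrow>
                      (\<forall>k. real (current_delay m j k) \<le> b * real m powr q + d) \<longrightarrow>
                      (\<forall>k. \<forall>\<omega>\<in>space M. \<eta> k \<omega> = arock_H1 r c q m (current_delay m j k)) \<longrightarrow>
                      epoch_complexity m (\<lambda>k. \<integral>\<omega>. arock_xi r c q m xstar x k \<omega> \<partial>M) \<epsilon> \<le> I m \<and>
                      epoch_complexity m (\<lambda>k. \<integral>\<omega>. (norm (x k \<omega> - xstar))\<^sup>2 \<partial>M) \<epsilon> \<le> I m)))"
    unfolding Let_def C_def[symmetric] s_def[symmetric] R_def[symmetric]
  proof (rule bexI[of _ e], intro conjI allI impI)
    show "e \<in> o(\<lambda>m. real m powr (q - 1/2))"
      using e unfolding p_def .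
    show "\<forall>\<^sub>F m in sequentially. \<forall>j :: nat \<Rightarrow> nat \<Rightarrow> nat.
        (\<forall>k. real (current_delay m j k) \<le> b * real m powr q + d) \<longrightarrow>
        (\<forall>k. arock_R r m (arock_H1 r c q m (current_delay m j k)) (arock_H2 r c q m (current_delay m j k))
          \<le> 1 - 1 / real m * s * (1 - C m + e m))"
      using rate unfolding R_def by eventually_elim blast
  next
    fix \<epsilon> :: real
    assume \<epsilon>: "0 < \<epsilon>" "\<epsilon> < 1"
    then have L: "0 < ln (1 / \<epsilon>)"
      by simp
    \<comment> \<open>Defined as whatever makes the claimed formula for the geometric sequence an identity; only
      its order of magnitude has to be proved.\<close>
    define e' where "e' m = epoch_complexity m (\<lambda>k. R m ^ k) \<epsilon> * s / ln (1 / \<epsilon>) - 1 - C m" for m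
    note expansion = epoch_complexity_expansion[OF s assms(4,5) \<epsilon> A, folded R_A]
    have "(\<lambda>m. (epoch_complexity m (\<lambda>k. R m ^ k) \<epsilon> * s / ln (1 / \<epsilon>) - 1 - (C m - e m)) - e m)
        \<in> o(\<lambda>m. real m powr (q - 1/2))"
      using expansion(1) e unfolding p_def by (rule sum_in_smallo)
    also have "(\<lambda>m. (epoch_complexity m (\<lambda>k. R m ^ k) \<epsilon> * s / ln (1 / \<epsilon>) - 1 - (C m - e m)) - e m) = e'"
      by (simp add: e'_def fun_eq_iff)
    finally have e': "e' \<in> o(\<lambda>m. real m powr (q - 1/2))" .
    have I: "epoch_complexity m (\<lambda>k. R m ^ k) \<epsilon> = (1 + C m + e' m) * (1 / s) * ln (1 / \<epsilon>)" for m
    proof -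
      have "1 + C m + e' m = epoch_complexity m (\<lambda>k. R m ^ k) \<epsilon> * s / ln (1 / \<epsilon>)"
        by (simp add: e'_def)
      then show ?thesis
        using s L by simp
    qed
    have "\<forall>\<^sub>F m in sequentially. \<forall>(M :: 'w measure) V (T :: 'h \<Rightarrow> 'h) xstar x blk \<eta> j.
        arock M m V T r xstar x blk \<eta> j \<longrightarrow>
        (\<forall>k. real (current_delay m j k) \<le> b * real m powr q + d) \<longrightarrow>
        (\<forall>k. \<forall>\<omega>\<in>space M. \<eta> k \<omega> = arock_H1 r c q m (current_delay m j k)) \<longrightarrow>
        epoch_complexity m (\<lambda>k. \<integral>\<omega>. arock_xi r c q m xstar x k \<omega> \<partial>M) \<epsilon> \<le> epoch_complexity m (\<lambda>k. R m ^ k) \<epsilon> \<and>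
        epoch_complexity m (\<lambda>k. \<integral>\<omega>. (norm (x k \<omega> - xstar))\<^sup>2 \<partial>M) \<epsilon> \<le> epoch_complexity m (\<lambda>k. R m ^ k) \<epsilon>"
      using rate expansion(2)
    proof (eventually_elim, intro allI impI)
      fix m and M :: "'w measure" and V and T :: "'h \<Rightarrow> 'h" and xstar x blk \<eta> j
      assume m: "1 \<le> m \<and> 0 < arock_gamma r c q m \<and> (\<forall>n. real n \<le> b * real m powr q + d \<longrightarrow>
          arock_R r m (arock_H1 r c q m n) (arock_H2 r c q m n) \<le> R m)"
        and R: "0 < R m \<and> R m < 1"
        and "arock M m V T r xstar x blk \<eta> j"
        and delay: "\<forall>k. real (current_delay m j k) \<le> b * real m powr q + d"
        and \<eta>_eq: "\<forall>k. \<forall>\<omega>\<in>space M. \<eta> k \<omega> = arock_H1 r c q m (current_delay m j k)"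
      then interpret arock M m V T r xstar x blk \<eta> j
        by simp
      have \<gamma>: "0 < arock_gamma r c q m"
        using m by simp
      note hyps = assms(1-3) \<gamma>
      have \<eta>: "\<forall>k. \<forall>\<omega>\<in>space M. 0 \<le> \<eta> k \<omega> \<and> \<eta> k \<omega> \<le> arock_H1 r c q m (current_delay m j k)"
        using \<eta>_eq arock_H1_pos[OF assms(1-3) m_pos \<gamma>] by (simp add: less_imp_le)
      show "epoch_complexity m (\<lambda>k. \<integral>\<omega>. arock_xi r c q m xstar x k \<omega> \<partial>M) \<epsilon> \<le> epoch_complexity m (\<lambda>k. R m ^ k) \<epsilon> \<and>
        epoch_complexity m (\<lambda>k. \<integral>\<omega>. (norm (x k \<omega> - xstar))\<^sup>2 \<partial>M) \<epsilon> \<le> epoch_complexity m (\<lambda>k. R m ^ k) \<epsilon>"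
        by (intro conjI epoch_complexity_le_geometric[OF hyps \<eta>]) (use m R \<epsilon> delay \<eta>_eq in auto)
    qed
    then show "\<exists>e' \<in> o(\<lambda>m. real m powr (q - 1/2)). \<forall>\<^sub>F m in sequentially.
        epoch_complexity m (\<lambda>k. (1 - 1 / real m * s * (1 - C m + e m)) ^ k) \<epsilon> = (1 + C m + e' m) * (1 / s) * ln (1 / \<epsilon>) \<and>
        (\<forall>(M :: 'w measure) V (T :: 'h \<Rightarrow> 'h) xstar x blk \<eta> j.
          arock M m V T r xstar x blk \<eta> j \<longrightarrow>
          (\<forall>k. real (current_delay m j k) \<le> b * real m powr q + d) \<longrightarrow>
          (\<forall>k. \<forall>\<omega>\<in>space M. \<eta> k \<omega> = arock_H1 r c q m (current_delay m j k)) \<longrightarrow>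
          epoch_complexity m (\<lambda>k. \<integral>\<omega>. arock_xi r c q m xstar x k \<omega> \<partial>M) \<epsilon> \<le> (1 + C m + e' m) * (1 / s) * ln (1 / \<epsilon>) \<and>
          epoch_complexity m (\<lambda>k. \<integral>\<omega>. (norm (x k \<omega> - xstar))\<^sup>2 \<partial>M) \<epsilon> \<le> (1 + C m + e' m) * (1 / s) * ln (1 / \<epsilon>))"
      unfolding R_def[symmetric] I[symmetric] by (intro bexI[OF _ e']) (simp add: I)
  qed
qed

end
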